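(* Let each of the quantum states $\rho_1,\dots,\rho_M$ on $\mathcal{H}_1\otimes\dots\otimes\mathcal{H}_N$ admit an $S_1\times\dots\times S_N$-setting LHV description. Then every convex combination $$\sum_{m}\gamma_m\rho_m,\qquad \gamma_m\ge0,\qquad \sum_m\gamma_m=1,$$ also admits the $S_1\times\dots\times S_N$-setting LHV description.
   Context: An $N$-partite quantum state $\rho$ is a density operator (positive, trace one) on $\mathcal{H}_1\otimes\dots\otimes\mathcal{H}_N$, where the $\mathcal{H}_n$ are complex separable Hilbert spaces. A POV measure $\mathrm{M}$ on an outcome set $\Lambda$ (an arbitrary measurable space; outcomes need not be real numbers and may be of any spectral type, discrete or continuous) with values in bounded operators on $\mathcal{H}$ is a $\sigma$-additive map from measurable sets to positive operators with $\mathrm{M}(\Lambda)=I$. An $S_1\times\dots\times S_N$-setting family of EPR local $N$-partite joint measurements performed on $\rho$ is given by POV measures $\mathrm{M}_n^{(s_n)}$ on $\Lambda_n^{(s_n)}$ with values on $\mathcal{H}_n$, $s_n=1,\dots,S_n$, $n=1,\dots,N$, with joint probability distributions $$P_{(s_1,\dots,s_N)}(D_1\times\dots\times D_N\,|\,\rho)=\mathrm{tr}\big[\rho\{\mathrm{M}_1^{(s_1)}(D_1)\otimes\dots\otimes\mathrm{M}_N^{(s_N)}(D_N)\}\big].$$ Such a family (with $S_1+\dots+S_N>N$) admits an LHV model if there exist a probability space $(\Omega,\mathcal{F}_\Omega,\nu)$ (which may depend on the whole family) and, for each $n$ and $s_n$, a conditional probability distribution $P_n^{(s_n)}(\cdot|\omega)$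 on $\Lambda_n^{(s_n)}$, defined for $\nu$-a.e. $\omega$, measurable in $\omega$, depending only on the setting $s_n$ at site $n$, such that for all $(s_1,\dots,s_N)$ and measurable $D_n$, $$P_{(s_1,\dots,s_N)}(D_1\times\dots\times D_N|\rho)=\int_\Omega P_1^{(s_1)}(D_1|\omega)\cdots P_N^{(s_N)}(D_N|\omega)\,\nu(d\omega).$$ The state $\rho$ admits an $S_1\times\dots\times S_N$-setting LHV description if every $S_1\times\dots\times S_N$-setting family of EPR local $N$-partite joint measurements performed on $\rho$ admits an LHV model. *)

theory Defs
  imports "HOL-Probability.Probability"
begin

text \<open>The inner product is conjugate-linear in its first argument.\<close>

class chilbert_space = banach +
  fixes scaleC :: "complex \<Rightarrow> 'a \<Rightarrow> 'a"  (infixr \<open>*\<^sub>C\<close> 75)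
    and cinner :: "'a \<Rightarrow> 'a \<Rightarrow> complex"
  assumes scaleC_add_right: "c *\<^sub>C (x + y) = c *\<^sub>C x + c *\<^sub>C y"
    and scaleC_add_left: "(c + d) *\<^sub>C x = c *\<^sub>C x + d *\<^sub>C x"
    and scaleC_scaleC: "c *\<^sub>C d *\<^sub>C x = (c * d) *\<^sub>C x"
    and scaleC_of_real: "of_real r *\<^sub>C x = r *\<^sub>R x"
    and cinner_commute: "cinner x y = cnj (cinner y x)"
    and cinner_add_right: "cinner x (y + z) = cinner x y + cinner x z"
    and cinner_scaleC_right: "cinner x (c *\<^sub>C y) = c * cinner x y"
    and cinner_same: "cinner x x = of_real ((norm x)\<^sup>2)"

lemma vector_space_scaleC: "vector_space (scaleC :: complex \<Rightarrow> 'a \<Rightarrow> 'a::chilbert_space)"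
proof
  fix x :: 'a
  show "1 *\<^sub>C x = x" using scaleC_of_real[of 1 x] by simp
qed (simp_all add: scaleC_add_right scaleC_add_left scaleC_scaleC)

text \<open>
  A finite family of Hilbert spaces of possibly different dimensions is represented by closed
  complex subspaces of one ambient Hilbert space (for instance, of their direct sum). No relation
  between the members of the family is assumed.
\<close>

definition separable_hilbert_subspace :: "'a::chilbert_space set \<Rightarrow> bool" where
  "separable_hilbert_subspace H \<longleftrightarrow>
     module.subspace scaleC H \<and> closed H \<and>
     (\<exists>D. countable D \<and> D \<subseteq> H \<and> H \<subseteq> closure D)"

text \<open>
  Operators on \<open>H\<close> are functions on the ambient space of which only the values on \<open>H\<close> matter.
\<close>

definition bounded_op :: "'a::chilbert_space set \<Rightarrow> ('a \<Rightarrow> 'a) \<Rightarrow> bool" where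
  "bounded_op H A \<longleftrightarrow>
     A ` H \<subseteq> H \<and>
     (\<forall>x\<in>H. \<forall>y\<in>H. A (x + y) = A x + A y) \<and>
     (\<forall>c. \<forall>x\<in>H. A (c *\<^sub>C x) = c *\<^sub>C A x) \<and>
     (\<exists>K. \<forall>x\<in>H. norm (A x) \<le> K * norm x)"

definition positive_op :: "'a::chilbert_space set \<Rightarrow> ('a \<Rightarrow> 'a) \<Rightarrow> bool" where
  "positive_op H A \<longleftrightarrow> bounded_op H A \<and> (\<forall>x\<in>H. cinner x (A x) \<in> \<real>\<^sub>\<ge>\<^sub>0)"

definition orthonormal_basis :: "'a::chilbert_space set \<Rightarrow> bool" where
  "orthonormal_basis E \<longleftrightarrow>
     (\<forall>e\<in>E. \<forall>f\<in>E. cinner e f = (if e = f then 1 else 0)) \<and>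
     closure (module.span scaleC E) = UNIV"

text \<open>
  On trace-class operators the value does not depend on the chosen orthonormal basis. A positive
  operator that is not trace class gets the value 0, because then the sum diverges.
\<close>

definition trace_op :: "('a::chilbert_space \<Rightarrow> 'a) \<Rightarrow> complex" where
  "trace_op A = (\<Sum>\<^sub>\<infinity>e\<in>(SOME E. orthonormal_basis E). cinner e (A e))"

definition quantum_state :: "('a::chilbert_space \<Rightarrow> 'a) \<Rightarrow> bool" where
  "quantum_state \<rho> \<longleftrightarrow> positive_op UNIV \<rho> \<and> trace_op \<rho> = 1"

text \<open>
  The Hilbert space \<open>'b\<close> together with \<open>\<tau> x = x 1 \<otimes> \<dots> \<otimes> x N\<close> is the Hilbert space tensor product
  of \<open>H 1, \<dots>, H N\<close>; these conditions determine it up to a unitary compatible with \<open>\<tau>\<close>.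
\<close>

definition hilbert_tensor_product ::
    "nat \<Rightarrow> (nat \<Rightarrow> 'a::chilbert_space set) \<Rightarrow> ((nat \<Rightarrow> 'a) \<Rightarrow> 'b::chilbert_space) \<Rightarrow> bool" where
  "hilbert_tensor_product N H \<tau> \<longleftrightarrow>
     (\<forall>x\<in>(\<Pi>\<^sub>E n\<in>{1..N}. H n). \<forall>n\<in>{1..N}. \<forall>u\<in>H n. \<forall>v\<in>H n. \<forall>c.
        \<tau> (x(n := u + v)) = \<tau> (x(n := u)) + \<tau> (x(n := v)) \<and>
        \<tau> (x(n := c *\<^sub>C u)) = c *\<^sub>C \<tau> (x(n := u))) \<and>
     (\<forall>x\<in>(\<Pi>\<^sub>E n\<in>{1..N}. H n). \<forall>y\<in>(\<Pi>\<^sub>E n\<in>{1..N}. H n).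
        cinner (\<tau> x) (\<tau> y) = (\<Prod>n=1..N. cinner (x n) (y n))) \<and>
     closure (module.span scaleC (\<tau> ` (\<Pi>\<^sub>E n\<in>{1..N}. H n))) = UNIV"

text \<open>The bounded operator \<open>A 1 \<otimes> \<dots> \<otimes> A N\<close>, for \<open>A n\<close> a bounded operator on \<open>H n\<close>.\<close>

definition tensor_op ::
    "nat \<Rightarrow> (nat \<Rightarrow> 'a::chilbert_space set) \<Rightarrow> ((nat \<Rightarrow> 'a) \<Rightarrow> 'b::chilbert_space)
      \<Rightarrow> (nat \<Rightarrow> 'a \<Rightarrow> 'a) \<Rightarrow> 'b \<Rightarrow> 'b" where
  "tensor_op N H \<tau> A =
     (THE B. bounded_op UNIV B \<and>
        (\<forall>x\<in>(\<Pi>\<^sub>E n\<in>{1..N}. H n). B (\<tau> x) = \<tau> (\<lambda>n\<in>{1..N}. A n (x n))))"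

text \<open>
  Of the outcome space \<open>\<Lambda> :: 'o measure\<close> only the underlying measurable space is used.
  Sigma-additivity is meant in the strong operator topology.
\<close>

definition pov_measure ::
    "'a::chilbert_space set \<Rightarrow> 'o measure \<Rightarrow> ('o set \<Rightarrow> 'a \<Rightarrow> 'a) \<Rightarrow> bool" where
  "pov_measure H \<Lambda> M \<longleftrightarrow>
     (\<forall>D\<in>sets \<Lambda>. positive_op H (M D)) \<and>
     (\<forall>x\<in>H. M (space \<Lambda>) x = x) \<and>
     (\<forall>D. range D \<subseteq> sets \<Lambda> \<longrightarrow> disjoint_family D \<longrightarrow>
        (\<forall>x\<in>H. (\<lambda>i. M (D i) x) sums M (\<Union>i. D i) x))"

definition measurement_family ::
    "nat \<Rightarrow> (nat \<Rightarrow> nat) \<Rightarrow> (nat \<Rightarrow> 'a::chilbert_space set) \<Rightarrow> (nat \<Rightarrow> nat \<Rightarrow> 'o measure)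
      \<Rightarrow> (nat \<Rightarrow> nat \<Rightarrow> 'o set \<Rightarrow> 'a \<Rightarrow> 'a) \<Rightarrow> bool" where
  "measurement_family N S H \<Lambda> M \<longleftrightarrow>
     (\<forall>n\<in>{1..N}. \<forall>s\<in>{1..S n}. pov_measure (H n) (\<Lambda> n s) (M n s))"

text \<open>The probability of the outcome set \<open>D 1 \<times> \<dots> \<times> D N\<close> under the setting \<open>(s 1, \<dots>, s N)\<close>.\<close>

definition joint_prob ::
    "nat \<Rightarrow> (nat \<Rightarrow> 'a::chilbert_space set) \<Rightarrow> ((nat \<Rightarrow> 'a) \<Rightarrow> 'b::chilbert_space)
      \<Rightarrow> (nat \<Rightarrow> nat \<Rightarrow> 'o set \<Rightarrow> 'a \<Rightarrow> 'a) \<Rightarrow> ('b \<Rightarrow> 'b) \<Rightarrow> (nat \<Rightarrow> nat) \<Rightarrow> (nat \<Rightarrow> 'o set)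
      \<Rightarrow> complex" where
  "joint_prob N H \<tau> M \<rho> s D = trace_op (\<rho> \<circ> tensor_op N H \<tau> (\<lambda>n. M n (s n) (D n)))"

text \<open>
  \<open>P n s \<omega>\<close> is the conditional distribution at site \<open>n\<close> under the setting \<open>s\<close>. It is a probability
  distribution on \<open>\<Lambda> n s\<close> for almost every \<open>\<omega>\<close> only.
\<close>

definition LHV_model ::
    "nat \<Rightarrow> (nat \<Rightarrow> nat) \<Rightarrow> (nat \<Rightarrow> nat \<Rightarrow> 'o measure)
      \<Rightarrow> ((nat \<Rightarrow> nat) \<Rightarrow> (nat \<Rightarrow> 'o set) \<Rightarrow> complex)
      \<Rightarrow> 'w measure \<Rightarrow> (nat \<Rightarrow> nat \<Rightarrow> 'w \<Rightarrow> 'o measure) \<Rightarrow> bool" where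
  "LHV_model N S \<Lambda> p \<nu> P \<longleftrightarrow>
     prob_space \<nu> \<and>
     (\<forall>n\<in>{1..N}. \<forall>s\<in>{1..S n}.
        (AE \<omega> in \<nu>. prob_space (P n s \<omega>) \<and> sets (P n s \<omega>) = sets (\<Lambda> n s)) \<and>
        (\<forall>D\<in>sets (\<Lambda> n s). (\<lambda>\<omega>. measure (P n s \<omega>) D) \<in> borel_measurable \<nu>)) \<and>
     (\<forall>s\<in>(\<Pi>\<^sub>E n\<in>{1..N}. {1..S n}). \<forall>D\<in>(\<Pi>\<^sub>E n\<in>{1..N}. sets (\<Lambda> n (s n))).
        p s D = of_real (\<integral>\<omega>. (\<Prod>n=1..N. measure (P n (s n) \<omega>) (D n)) \<partial>\<nu>))"

text \<open>
  HOL cannot quantify over the type of the hidden variables, so a type is fixed that is large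
  enough: a hidden variable is a family of measures indexed by site and setting. By
  \<open>admits_LHV_model_if_LHV_model\<close> below, a model over any other type yields one over this type.
\<close>

definition admits_LHV_model ::
    "nat \<Rightarrow> (nat \<Rightarrow> nat) \<Rightarrow> (nat \<Rightarrow> nat \<Rightarrow> 'o measure)
      \<Rightarrow> ((nat \<Rightarrow> nat) \<Rightarrow> (nat \<Rightarrow> 'o set) \<Rightarrow> complex) \<Rightarrow> bool" where
  "admits_LHV_model N S \<Lambda> p \<longleftrightarrow>
     (\<exists>(\<nu> :: (nat \<Rightarrow> nat \<Rightarrow> 'o measure) measure) P. LHV_model N S \<Lambda> p \<nu> P)"

lemma admits_LHV_model_if_LHV_model:
  fixes \<nu> :: "'w measure"
  assumes "LHV_model N S \<Lambda> p \<nu> P"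
  shows "admits_LHV_model N S \<Lambda> p"
proof -
  let ?\<nu> = "completion \<nu>"
  define F where "F = (\<lambda>\<omega> n s. P n s \<omega>)"
  define \<A> where "\<A> = {A. F -` A \<inter> space ?\<nu> \<in> sets ?\<nu>}"
  define T where "T = sigma UNIV \<A>"
  interpret prob_space \<nu> using assms by (simp add: LHV_model_def)
  interpret c: prob_space ?\<nu>
    by (rule prob_spaceI) (simp add: emeasure_space_1 sets.top)
  have "sigma_algebra UNIV \<A>"
    unfolding sigma_algebra_iff2
  proof (intro conjI ballI allI impI)
    show "UNIV - A \<in> \<A>" if "A \<in> \<A>" for A
    proof -
      have "F -` (UNIV - A) \<inter> space ?\<nu> = space ?\<nu> - (F -` A \<inter> space ?\<nu>)" by auto
      then show ?thesis using that by (auto simp: \<A>_def simp del: space_completion)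
    qed
    show "(\<Union>i. A i) \<in> \<A>" if "range A \<subseteq> \<A>" for A :: "nat \<Rightarrow> _"
    proof -
      have "F -` (\<Union>i. A i) \<inter> space ?\<nu> = (\<Union>i. F -` A i \<inter> space ?\<nu>)" by auto
      moreover have "\<dots> \<in> sets ?\<nu>"
        by (rule sets.countable_UN) (use that in \<open>auto simp: \<A>_def\<close>)
      ultimately show ?thesis by (simp add: \<A>_def)
    qed
  qed (auto simp: \<A>_def)
  then have sets_T: "sets T = \<A>" and space_T: "space T = UNIV"
    by (simp_all add: T_def sigma_algebra.sigma_sets_eq)
  have F: "F \<in> measurable ?\<nu> T"
    by (rule measurableI) (auto simp: sets_T space_T \<A>_def)
  define \<mu> where "\<mu> = distr ?\<nu> T F"
  have meas: "g \<in> borel_measurable \<mu>" if "(\<lambda>\<omega>. g (F \<omega>)) \<in> borel_measurable \<nu>"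
    for g :: "_ \<Rightarrow> real"
  proof (rule measurableI)
    fix A :: "real set" assume "A \<in> sets borel"
    moreover have "(\<lambda>\<omega>. g (F \<omega>)) \<in> borel_measurable ?\<nu>"
      using that by (rule measurable_completion)
    ultimately have "(\<lambda>\<omega>. g (F \<omega>)) -` A \<inter> space ?\<nu> \<in> sets ?\<nu>" by (rule measurable_sets[rotated])
    moreover have "(\<lambda>\<omega>. g (F \<omega>)) -` A \<inter> space ?\<nu> = F -` (g -` A) \<inter> space ?\<nu>" by auto
    ultimately show "g -` A \<inter> space \<mu> \<in> sets \<mu>" by (simp add: \<mu>_def sets_T space_T \<A>_def)
  qed simp
  have AE: "AE w in \<mu>. Q w" if "AE \<omega> in \<nu>. Q (F \<omega>)" for Q
  proof -
    have *: "AE \<omega> in ?\<nu>. Q (F \<omega>)" using that by (simp add: AE_completion_iff)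
    have "Measurable.pred ?\<nu> (\<lambda>\<omega>. \<not> Q (F \<omega>))"
      using that by (intro sets_completion_AE) simp
    then have "Measurable.pred ?\<nu> (\<lambda>\<omega>. Q (F \<omega>))"
      using pred_intros_logic(2)[where P="\<lambda>\<omega>. \<not> Q (F \<omega>)" and M="?\<nu>"]
      by (simp only: not_not)
    then have "{\<omega> \<in> space ?\<nu>. Q (F \<omega>)} \<in> sets ?\<nu>" by (rule predE)
    moreover have "{\<omega> \<in> space ?\<nu>. Q (F \<omega>)} = F -` {w. Q w} \<inter> space ?\<nu>" by auto
    ultimately have "{w \<in> space T. Q w} \<in> sets T" by (simp add: sets_T space_T \<A>_def)
    then show ?thesis using * AE_distr_iff[OF F] unfolding \<mu>_def by blast
  qed
  have "LHV_model N S \<Lambda> p \<mu> (\<lambda>n s w. w n s)"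
    unfolding LHV_model_def
  proof (intro conjI ballI)
    show "prob_space \<mu>" unfolding \<mu>_def by (rule c.prob_space_distr[OF F])
  next
    fix n s assume "n \<in> {1..N}" "s \<in> {1..S n}"
    then show "AE w in \<mu>. prob_space (w n s) \<and> sets (w n s) = sets (\<Lambda> n s)"
      using assms by (intro AE) (auto simp: LHV_model_def F_def)
  next
    fix n s D assume "n \<in> {1..N}" "s \<in> {1..S n}" "D \<in> sets (\<Lambda> n s)"
    then show "(\<lambda>w. measure (w n s) D) \<in> borel_measurable \<mu>"
      using assms by (intro meas) (auto simp: LHV_model_def F_def)
  next
    fix s D assume s: "s \<in> (\<Pi>\<^sub>E n\<in>{1..N}. {1..S n})" 
      and D: "D \<in> (\<Pi>\<^sub>E n\<in>{1..N}. sets (\<Lambda> n (s n)))"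
    let ?g = "\<lambda>w. \<Prod>n=1..N. measure (w n (s n)) (D n)"
    have g: "(\<lambda>\<omega>. ?g (F \<omega>)) \<in> borel_measurable \<nu>"
      unfolding F_def
    proof (rule borel_measurable_prod)
      fix n assume n: "n \<in> {1..N}"
      with s D have "s n \<in> {1..S n}" "D n \<in> sets (\<Lambda> n (s n))" by auto
      with n assms show "(\<lambda>\<omega>. measure (P n (s n) \<omega>) (D n)) \<in> borel_measurable \<nu>"
        unfolding LHV_model_def by blast
    qed
    have "?g \<in> borel_measurable T" using meas[OF g] by (simp add: \<mu>_def)
    then have "(\<integral>w. ?g w \<partial>\<mu>) = (\<integral>\<omega>. ?g (F \<omega>) \<partial>?\<nu>)"
      unfolding \<mu>_def by (rule integral_distr[OF F])
    also have "\<dots> = (\<integral>\<omega>. ?g (F \<omega>) \<partial>\<nu>)" using g by (rule integral_completion)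
    finally show "p s D = of_real (\<integral>w. ?g w \<partial>\<mu>)"
      using assms s D by (simp add: LHV_model_def F_def)
  qed
  then show ?thesis unfolding admits_LHV_model_def by blast
qed

text \<open>
  The type argument \<open>'o\<close> is the type of measurement outcomes. The outcome spaces of the different
  sites and settings are arbitrary measurable spaces over this type.
\<close>

definition admits_LHV_description ::
    "'o itself \<Rightarrow> nat \<Rightarrow> (nat \<Rightarrow> nat) \<Rightarrow> (nat \<Rightarrow> 'a::chilbert_space set)
      \<Rightarrow> ((nat \<Rightarrow> 'a) \<Rightarrow> 'b::chilbert_space) \<Rightarrow> ('b \<Rightarrow> 'b) \<Rightarrow> bool" where
  "admits_LHV_description _ N S H \<tau> \<rho> \<longleftrightarrow>
     quantum_state \<rho> \<and>
     (\<forall>(\<Lambda> :: nat \<Rightarrow> nat \<Rightarrow> 'o measure) M.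
        measurement_family N S H \<Lambda> M \<longrightarrow> admits_LHV_model N S \<Lambda> (joint_prob N H \<tau> M \<rho>))"

end

theory Submission
  imports Defs
begin

text \<open>
  The hidden-variable space of the mixture is the disjoint union of the given ones, weighted by
  \<open>\<gamma>\<close>. The analytic content is that the joint probabilities are affine in the state: for this the
  trace series of \<open>\<rho> T\<close>, with \<open>T\<close> a tensor product of bounded operators, has to converge, because a
  divergent series would be given the value 0. So \<open>T\<close> must be shown to exist as a bounded operator,
  and \<open>tr \<bar>\<rho> T\<bar> < \<infinity>\<close> follows from the Cauchy-Schwarz inequality for the form \<open>\<langle>x, \<rho> y\<rangle>\<close> together with
  \<open>tr (T\<^sup>* \<rho> T) \<le> \<parallel>T\<parallel>\<^sup>2 tr \<rho>\<close>.
\<close>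

section \<open>Hilbert spaces\<close>

text \<open>A convex combination of product distributions is in general not a product, so the label
  of the component has to be part of the hidden variable. Given the label and the variable of that
  component, the response at a site still depends on the local setting alone. On the operator side,
  two objects are specified only by choice: the basis inside \<open>trace_op\<close> and the
  operator \<open>tensor_op\<close>. Nothing can be said about them before an orthonormal basis is
  shown to exist and the description of the tensor operator is shown to have exactly one solution.
  The space \<open>'b\<close> is accessible only through inner products of product vectors, hence
  norm bounds on tensor operators come from Gram matrices, one site at a time. The trace estimate is
  brought down to finitely many vectors, the images of finitely many basis vectors. Each rank-one
  part split off from the state takes a known amount of trace with it, so neither adjoints nor
  square roots have to be constructed.\<close>

interpretation chilbert: vector_space "scaleC :: complex \<Rightarrow> 'a \<Rightarrow> 'a::chilbert_space"
  by (rule vector_space_scaleC)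

lemma cinner_scaleR_right: "cinner x (r *\<^sub>R y) = of_real r * cinner x y"
  by (metis cinner_scaleC_right scaleC_of_real)

lemma linear_cinner_right: "linear (cinner x)"
  by (rule linearI) (simp_all add: cinner_add_right cinner_scaleR_right scaleR_conv_of_real)

lemmas cinner_sum_right = linear_sum[OF linear_cinner_right]
  and cinner_diff_right = linear_diff[OF linear_cinner_right]
  and cinner_zero_right [simp] = linear_0[OF linear_cinner_right]

lemma cinner_add_left: "cinner (x + y) z = cinner x z + cinner y z"
  by (metis cinner_add_right cinner_commute complex_cnj_add)

lemma cinner_diff_left: "cinner (x - y) z = cinner x z - cinner y z"
  by (metis cinner_diff_right cinner_commute complex_cnj_diff)

lemma cinner_scaleC_left: "cinner (c *\<^sub>C x) y = cnj c * cinner x y"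
  by (metis cinner_commute cinner_scaleC_right complex_cnj_mult)

lemma cinner_zero_left [simp]: "cinner 0 x = 0"
  by (metis cinner_commute cinner_zero_right complex_cnj_zero)

lemma cinner_sum_left: "cinner (sum f A) y = (\<Sum>i\<in>A. cinner (f i) y)"
  by (induction A rule: infinite_finite_induct) (simp_all add: cinner_add_left)

lemma cinner_eq_0_commute: "cinner x y = 0 \<longleftrightarrow> cinner y x = 0"
  by (metis cinner_commute complex_cnj_zero)

lemma power2_norm_eq_cinner: "complex_of_real ((norm x)\<^sup>2) = cinner x x"
  by (simp add: cinner_same)

lemma Re_cinner_same: "Re (cinner x x) = (norm x)\<^sup>2"
  by (simp add: cinner_same)

section \<open>Bounded and positive operators, Cauchy-Schwarz inequalities\<close>

lemma positive_op_UNIV_iff: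
  "positive_op UNIV A \<longleftrightarrow> bounded_op UNIV A \<and> (\<forall>x. 0 \<le> Re (cinner x (A x)) \<and> Im (cinner x (A x)) = 0)"
  by (simp add: positive_op_def complex_nonneg_Reals_iff)

lemma bounded_op_add: "bounded_op H A \<Longrightarrow> x \<in> H \<Longrightarrow> y \<in> H \<Longrightarrow> A (x + y) = A x + A y"
  and bounded_op_scaleC: "bounded_op H A \<Longrightarrow> x \<in> H \<Longrightarrow> A (c *\<^sub>C x) = c *\<^sub>C A x"
  and bounded_op_in: "bounded_op H A \<Longrightarrow> x \<in> H \<Longrightarrow> A x \<in> H"
  by (auto simp: bounded_op_def)

lemma bounded_op_bound:
  assumes "bounded_op H A"
  obtains K where "K \<ge> 0" "\<And>x. x \<in> H \<Longrightarrow> norm (A x) \<le> K * norm x"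
proof -
  obtain K where K: "\<forall>x\<in>H. norm (A x) \<le> K * norm x" using assms by (auto simp: bounded_op_def)
  have "norm (A x) \<le> max K 0 * norm x" if "x \<in> H" for x
    using K that by (meson max.cobounded1 mult_right_mono norm_ge_zero order_trans)
  then show ?thesis using that[of "max K 0"] by simp
qed

lemma bounded_op_sum:
  assumes "bounded_op H A" "module.subspace scaleC H" "\<And>i. i \<in> I \<Longrightarrow> f i \<in> H"
  shows "A (\<Sum>i\<in>I. c i *\<^sub>C f i) = (\<Sum>i\<in>I. c i *\<^sub>C A (f i))"
  using assms(3)
proof (induction I rule: infinite_finite_induct)
  case (insert i I)
  then have "(\<Sum>i\<in>I. c i *\<^sub>C f i) \<in> H" "c i *\<^sub>C f i \<in> H"
    using assms(2) by (auto intro!: chilbert.subspace_sum chilbert.subspace_scale)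
  then show ?case using insert assms(1) by (simp add: bounded_op_add bounded_op_scaleC)
qed (use bounded_op_scaleC[OF assms(1), of 0 0] chilbert.subspace_0[OF assms(2)] in auto)

text \<open>Polarization: since the quadratic form is real, its value at \<open>x + y\<close>
  relates the imaginary parts and its value at \<open>x + i y\<close> relates the real
  parts.\<close>

lemma positive_op_hermitian:
  assumes "positive_op UNIV A"
  shows "cinner x (A y) = cnj (cinner y (A x))"
proof -
  have A: "A (u + v) = A u + A v" "A (c *\<^sub>C u) = c *\<^sub>C A u" for u v c
    using assms by (auto simp: positive_op_def bounded_op_def)
  have Im: "Im (cinner z (A z)) = 0" for z
    using assms by (simp add: positive_op_UNIV_iff)
  have "Im (cinner x (A y)) = - Im (cinner y (A x))"
    using Im[of "x + y"] Im[of x] Im[of y] by (simp add: A cinner_add_left cinner_add_right)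
  moreover have "Re (cinner x (A y)) = Re (cinner y (A x))"
    using Im[of "x + \<i> *\<^sub>C y"] Im[of x] Im[of y]
    by (simp add: A cinner_add_left cinner_add_right cinner_scaleC_left cinner_scaleC_right)
  ultimately show ?thesis by (simp add: complex_eq_iff)
qed

text \<open>The form at \<open>x + c y\<close> is nonnegative. The phase of \<open>c\<close> is
  chosen so that only a real quadratic polynomial in \<open>t\<close> remains. If
  \<open>b > 0\<close>, its minimum at \<open>t = -1/b\<close> gives the claim; the form may be
  degenerate, so \<open>b = 0\<close> is a separate case.\<close>

lemma positive_op_Cauchy_Schwarz:
  assumes "positive_op UNIV A"
  shows "(cmod (cinner x (A y)))\<^sup>2 \<le> Re (cinner x (A x)) * Re (cinner y (A y))"
proof -
  define a b z where "a = Re (cinner x (A x))" and "b = Re (cinner y (A y))" and "z = cinner x (A y)"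
  have A: "A (u + v) = A u + A v" "A (c *\<^sub>C u) = c *\<^sub>C A u" for u v c
    using assms by (auto simp: positive_op_def bounded_op_def)
  have "b \<ge> 0" using assms by (simp add: b_def positive_op_UNIV_iff)
  have xx: "cinner x (A x) = of_real a" and yy: "cinner y (A y) = of_real b"
    using assms by (simp_all add: a_def b_def positive_op_UNIV_iff complex_eq_iff)
  have yx: "cinner y (A x) = cnj z" unfolding z_def by (rule positive_op_hermitian[OF assms])
  have q: "0 \<le> a + 2 * t * (cmod z)\<^sup>2 + t\<^sup>2 * (cmod z)\<^sup>2 * b" for t
  proof -
    \<comment> \<open>With this phase both cross terms equal \<open>t * (cmod z)^2\<close>.\<close>
    define c where "c = of_real t * cnj z"
    have "0 \<le> Re (cinner (x + c *\<^sub>C y) (A (x + c *\<^sub>C y)))"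
      using assms by (simp add: positive_op_UNIV_iff)
    also have "cinner (x + c *\<^sub>C y) (A (x + c *\<^sub>C y)) =
        of_real a + c * z + cnj c * cnj z + cnj c * c * of_real b"
      by (simp add: A cinner_add_left cinner_add_right cinner_scaleC_left cinner_scaleC_right xx yy yx
          flip: z_def) (simp add: algebra_simps)
    also have "\<dots> = of_real (a + 2 * t * (cmod z)\<^sup>2 + t\<^sup>2 * (cmod z)\<^sup>2 * b)"
    proof -
      have "complex_of_real ((cmod z)\<^sup>2) = z * cnj z" by (rule complex_norm_square)
      then show ?thesis
        unfolding c_def of_real_add of_real_mult of_real_power[of t] complex_cnj_mult
          complex_cnj_complex_of_real complex_cnj_cnj
        by (simp del: of_real_power) (simp add: algebra_simps power2_eq_square del: of_real_power)
    qed
    finally show ?thesis by simp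
  qed
  show ?thesis
  proof (cases "b = 0")
    case True
    have "z = 0"
    proof (rule ccontr)
      assume "z \<noteq> 0"
      then have "(cmod z)\<^sup>2 > 0" by simp
      \<comment> \<open>For \<open>b = 0\<close> the polynomial is affine in \<open>t\<close>, and
        at \<open>t = -(a + 1) / (2 * (cmod z)^2)\<close> it takes the value -1.\<close>
      then show False using q[of "- (a + 1) / (2 * (cmod z)\<^sup>2)"] True
        q[of "- (\<bar>a\<bar> + 1) / (2 * (cmod z)\<^sup>2)"] by (simp add: field_simps)
    qed
    then show ?thesis using True by (simp flip: z_def b_def)
  next
    case False
    with \<open>b \<ge> 0\<close> have "b > 0" by simp
    with q[of "- 1 / b"] have "(cmod z)\<^sup>2 \<le> a * b" by (simp add: field_simps power2_eq_square)
    then show ?thesis by (simp add: a_def b_def z_def)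
  qed
qed

text \<open>Makes the ordinary Cauchy-Schwarz inequality an instance of the one for positive
  operators.\<close>

lemma positive_op_id: "positive_op UNIV (\<lambda>x. x)"
  unfolding positive_op_UNIV_iff bounded_op_def
  by (auto simp: Re_cinner_same simp flip: power2_norm_eq_cinner intro!: exI[of _ 1])

lemma bounded_op_id: "bounded_op UNIV (\<lambda>x. x)"
  using positive_op_id unfolding positive_op_def by (rule conjunct1)

lemma cmod_cinner_le: "cmod (cinner x y) \<le> norm x * norm y"
  using positive_op_Cauchy_Schwarz[OF positive_op_id, of x y]
  unfolding Re_cinner_same power_mult_distrib[symmetric]
  by (rule power2_le_imp_le) simp

lemma bounded_linear_cinner_right: "bounded_linear (cinner x)"
proof (rule bounded_linear_intro[where K = "norm x"])
  show "cinner x (r *\<^sub>R y) = r *\<^sub>R cinner x y" for r y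
    by (simp add: cinner_scaleR_right scaleR_conv_of_real)
  show "cmod (cinner x y) \<le> norm y * norm x" for y
    using cmod_cinner_le by (simp only: mult.commute)
qed (rule cinner_add_right)

lemma norm_scaleC: "norm (c *\<^sub>C x) = cmod c * norm x"
proof -
  have "complex_of_real ((norm (c *\<^sub>C x))\<^sup>2) = (c * cnj c) * cinner x x"
    unfolding power2_norm_eq_cinner cinner_scaleC_left cinner_scaleC_right by simp
  also have "\<dots> = of_real ((cmod c)\<^sup>2 * (norm x)\<^sup>2)"
    unfolding of_real_mult complex_norm_square cinner_same by simp
  finally have "(norm (c *\<^sub>C x))\<^sup>2 = (cmod c * norm x)\<^sup>2"
    unfolding of_real_eq_iff power_mult_distrib .
  then show ?thesis by simp
qed

lemma bounded_linear_scaleC_right: "bounded_linear (scaleC c)"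
proof (rule bounded_linear_intro[where K = "cmod c"])
  show "c *\<^sub>C r *\<^sub>R x = r *\<^sub>R c *\<^sub>C x" for r and x :: 'a
    unfolding scaleC_of_real[symmetric] scaleC_scaleC by (simp only: mult.commute)
qed (simp_all add: scaleC_add_right norm_scaleC mult.commute)

lemma norm_add_square:
  "(norm (x + y))\<^sup>2 = (norm x)\<^sup>2 + (norm y)\<^sup>2 + 2 * Re (cinner x y)"
proof -
  have "Re (cinner y x) = Re (cinner x y)" by (subst cinner_commute) simp
  then show ?thesis by (simp add: cinner_add_left cinner_add_right flip: Re_cinner_same)
qed

lemma norm_diff_square:
  "(norm (x - y))\<^sup>2 = (norm x)\<^sup>2 + (norm y)\<^sup>2 - 2 * Re (cinner x y)"
proof -
  have "Re (cinner y x) = Re (cinner x y)" by (subst cinner_commute) simp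
  then show ?thesis by (simp add: cinner_diff_left cinner_diff_right flip: Re_cinner_same)
qed


section \<open>Nearest points, orthonormal bases and Parseval's identity\<close>

lemma orthogonal_complement_nontrivial:
  fixes C :: "'a::chilbert_space set"
  assumes C: "module.subspace scaleC C" "closed C" and x: "x \<notin> C"
  obtains z where "z \<noteq> 0" "\<And>y. y \<in> C \<Longrightarrow> cinner y z = 0"
proof -
  have sub: "0 \<in> C" "\<And>u v. u \<in> C \<Longrightarrow> v \<in> C \<Longrightarrow> u + v \<in> C" "\<And>c u. u \<in> C \<Longrightarrow> c *\<^sub>C u \<in> C"
    using C(1) by (auto intro: chilbert.subspace_0 chilbert.subspace_add chilbert.subspace_scale)
  \<comment> \<open>The vector sought is \<open>x - p\<close> with \<open>p\<close> a point of
    \<open>C\<close> nearest to \<open>x\<close>. Such a point is the limit of a minimizing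
    sequence, which is Cauchy by the parallelogram law.\<close>
  define d where "d = infdist x C"
  have d: "d \<le> norm (x - u)" if "u \<in> C" for u
    using infdist_le[OF that, of x] by (simp add: d_def dist_norm)
  have "d \<ge> 0" by (simp add: d_def infdist_nonneg)
  have "\<exists>u\<in>C. norm (x - u) < d + 1 / real (Suc n)" for n
  proof -
    have "\<exists>u\<in>C. dist x u < d + 1 / real (Suc n)"
      using cInf_lessD[of "dist x ` C" "d + 1 / real (Suc n)"] sub(1)
      by (auto simp: d_def infdist_def)
    then show ?thesis by (simp add: dist_norm)
  qed
  then obtain y where y: "\<And>n. y n \<in> C" "\<And>n. norm (x - y n) < d + 1 / real (Suc n)" by metis
  \<comment> \<open>Parallelogram law for \<open>x - u\<close> and \<open>x - v\<close>: the
    midpoint of \<open>u\<close> and \<open>v\<close> lies in \<open>C\<close>, so the sum of the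
    two vectors has norm at least \<open>2 * d\<close>.\<close>
  have par: "(norm (u - v))\<^sup>2 \<le> 2 * (norm (x - u))\<^sup>2 + 2 * (norm (x - v))\<^sup>2 - 4 * d\<^sup>2"
    if "u \<in> C" "v \<in> C" for u v
  proof -
    have "(1/2::real) *\<^sub>R (u + v) \<in> C"
      using that sub(2)[of u v] sub(3)[of "u + v" "of_real (1/2)"] by (simp only: scaleC_of_real)
    then have "d \<le> norm (x - (1/2::real) *\<^sub>R (u + v))" by (rule d)
    also have "x - (1/2::real) *\<^sub>R (u + v) = (1/2::real) *\<^sub>R ((x - u) + (x - v))"
      by (simp add: algebra_simps flip: scaleR_add_left)
    finally have "2 * d \<le> norm ((x - u) + (x - v))" by simp
    then have "4 * d\<^sup>2 \<le> (norm ((x - u) + (x - v)))\<^sup>2"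
      using power_mono[of "2 * d" _ 2] \<open>d \<ge> 0\<close> by (simp add: power_mult_distrib)
    moreover have "norm (u - v) = norm ((x - u) - (x - v))" by (simp add: norm_minus_commute)
    ultimately show ?thesis using norm_add_square[of "x - u" "x - v"] norm_diff_square[of "x - u" "x - v"]
      by simp
  qed
  \<comment> \<open>The excess over \<open>d^2\<close> is \<open>2 * d * r + r^2\<close> with
    \<open>r = 1 / (N + 1)\<close>; since \<open>r\<close> is at most 1, it is at most
    \<open>(2 * d + 1) * r\<close>.\<close>
  have near: "(norm (x - y n))\<^sup>2 \<le> d\<^sup>2 + (2 * d + 1) / real (Suc N)" if "N \<le> n" for n N
  proof -
    have le: "1 / real (Suc n) \<le> 1 / real (Suc N)" using that by (simp add: frac_le)
    have "norm (x - y n) \<le> d + 1 / real (Suc N)" using y(2)[of n] le by linarith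
    then have "(norm (x - y n))\<^sup>2 \<le> (d + 1 / real (Suc N))\<^sup>2" by (intro power_mono) auto
    also have "\<dots> = d\<^sup>2 + 2 * d / real (Suc N) + (1 / real (Suc N)) * (1 / real (Suc N))"
      by (simp add: power2_eq_square algebra_simps)
    also have "(1 / real (Suc N)) * (1 / real (Suc N)) \<le> 1 * (1 / real (Suc N))"
      by (intro mult_right_mono) auto
    finally show ?thesis by (simp add: add_divide_distrib)
  qed
  have "Cauchy y"
  proof (rule metric_CauchyI)
    fix e :: real assume "e > 0"
    \<comment> \<open>Inserting \<open>near\<close> twice into \<open>par\<close> cancels the terms
      in \<open>d^2\<close> and leaves four times the excess, which has to stay below
      \<open>e^2\<close>.\<close>
    then obtain N where N: "4 * (2 * d + 1) / e\<^sup>2 < real N" using reals_Archimedean2 by blast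
    then have "4 * (2 * d + 1) / e\<^sup>2 < real (Suc N)" by simp
    then have small: "4 * (2 * d + 1) / real (Suc N) < e\<^sup>2"
      using \<open>e > 0\<close> by (simp add: field_simps del: of_nat_Suc)
    have "dist (y m) (y n) < e" if "m \<ge> N" "n \<ge> N" for m n
    proof -
      have "(norm (y m - y n))\<^sup>2 \<le> 4 * ((2 * d + 1) / real (Suc N))"
        using par[OF y(1) y(1), of m n] near[OF that(1)] near[OF that(2)] by linarith
      also have "\<dots> < e\<^sup>2" using small by simp
      finally show ?thesis using \<open>e > 0\<close> by (simp add: dist_norm power2_less_imp_less)
    qed
    then show "\<exists>M. \<forall>m\<ge>M. \<forall>n\<ge>M. dist (y m) (y n) < e" by blast
  qed
  then obtain p where p: "y \<longlonglongrightarrow> p" using Cauchy_convergent_iff convergent_def by blast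
  have "p \<in> C" using closed_sequentially[OF C(2) _ p] y(1) by blast
  have "(\<lambda>n. norm (x - y n)) \<longlonglongrightarrow> norm (x - p)" by (intro tendsto_intros p)
  moreover have "(\<lambda>n. d + 1 / real (Suc n)) \<longlonglongrightarrow> d + 0"
    by (intro tendsto_intros LIMSEQ_Suc[OF lim_1_over_n])
  ultimately have "norm (x - p) \<le> d + 0"
    by (rule LIMSEQ_le) (use y(2) less_imp_le in blast)
  with d[OF \<open>p \<in> C\<close>] have pd: "norm (x - p) = d" by simp
  define z where "z = x - p"
  have "z \<noteq> 0" using x \<open>p \<in> C\<close> by (auto simp: z_def)
  moreover have "cinner v z = 0" if v: "v \<in> C" for v
  proof (cases "v = 0")
    case False
    \<comment> \<open>\<open>c v\<close> is the projection of \<open>z\<close> onto the line of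
      \<open>v\<close>. Subtracting it would bring \<open>x\<close> nearer to \<open>C\<close> by a
      definite amount unless \<open>cinner v z = 0\<close>.\<close>
    define c where "c = cinner v z / of_real ((norm v)\<^sup>2)"
    have "norm z \<le> norm (z - c *\<^sub>C v)"
      using d[OF sub(2)[OF \<open>p \<in> C\<close> sub(3)[OF v]]] pd by (simp add: z_def diff_diff_eq)
    then have "(norm z)\<^sup>2 \<le> (norm (z - c *\<^sub>C v))\<^sup>2" by (simp add: power_mono)
    also have "\<dots> = (norm z)\<^sup>2 + (cmod c)\<^sup>2 * (norm v)\<^sup>2 - 2 * Re (c * cinner z v)"
      by (simp add: norm_diff_square norm_scaleC power_mult_distrib cinner_scaleC_right)
    also have "c * cinner z v = of_real ((cmod (cinner v z))\<^sup>2 / (norm v)\<^sup>2)"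
      unfolding c_def by (subst cinner_commute[of z v]) (simp only: of_real_divide complex_norm_square times_divide_eq_left)
    also have "(cmod c)\<^sup>2 * (norm v)\<^sup>2 = (cmod (cinner v z))\<^sup>2 / (norm v)\<^sup>2"
    proof -
      have "cmod c = cmod (cinner v z) / (norm v)\<^sup>2" by (simp add: c_def norm_divide norm_power)
      then show ?thesis using False by (simp add: power2_eq_square)
    qed
    finally have "(cmod (cinner v z))\<^sup>2 / (norm v)\<^sup>2 \<le> 0" by simp
    then show ?thesis using False by (simp add: divide_le_0_iff)
  qed simp
  ultimately show ?thesis using that by blast
qed

lemma subspace_closure:
  assumes "module.subspace scaleC (A :: 'a::chilbert_space set)"
  shows "module.subspace scaleC (closure A)"
proof (rule chilbert.subspaceI)
  show "0 \<in> closure A" using chilbert.subspace_0[OF assms] closure_subset by blast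
next
  fix x y assume "x \<in> closure A" "y \<in> closure A"
  then obtain f g where "\<And>n. f n \<in> A" "f \<longlonglongrightarrow> x" "\<And>n. g n \<in> A" "g \<longlonglongrightarrow> y"
    unfolding closure_sequential by metis
  then show "x + y \<in> closure A"
    unfolding closure_sequential
    by (intro exI[of _ "\<lambda>n. f n + g n"]) (auto intro: chilbert.subspace_add[OF assms] tendsto_add)
next
  fix c x assume "x \<in> closure A"
  then obtain f where "\<And>n. f n \<in> A" "f \<longlonglongrightarrow> x" unfolding closure_sequential by metis
  then show "c *\<^sub>C x \<in> closure A"
    unfolding closure_sequential
    by (intro exI[of _ "\<lambda>n. c *\<^sub>C f n"])
      (auto intro: chilbert.subspace_scale[OF assms] bounded_linear.tendsto[OF bounded_linear_scaleC_right])
qed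

text \<open>Zorn's lemma gives a maximal orthonormal set. If its span were not dense, a unit vector
  orthogonal to the closure of the span could be added.\<close>

lemma orthonormal_basis_exists: "\<exists>E :: 'a::chilbert_space set. orthonormal_basis E"
proof -
  define \<O> :: "'a set set" where "\<O> = {E. \<forall>e\<in>E. \<forall>f\<in>E. cinner e f = (if e = f then 1 else 0)}"
  have "\<exists>E\<in>\<O>. \<forall>X\<in>\<O>. E \<subseteq> X \<longrightarrow> X = E"
  proof (rule subset_Zorn')
    fix C assume C: "subset.chain \<O> C"
    show "\<Union>C \<in> \<O>"
      unfolding \<O>_def
    proof (intro CollectI ballI)
      fix e f assume "e \<in> \<Union>C" "f \<in> \<Union>C"
      then obtain X Y where "X \<in> C" "Y \<in> C" "e \<in> X" "f \<in> Y" by blast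
      moreover have "X \<subseteq> Y \<or> Y \<subseteq> X" "X \<in> \<O>" "Y \<in> \<O>"
        using C \<open>X \<in> C\<close> \<open>Y \<in> C\<close> unfolding subset.chain_def by blast+
      ultimately have "\<exists>Z\<in>\<O>. e \<in> Z \<and> f \<in> Z" by blast
      then show "cinner e f = (if e = f then 1 else 0)" by (auto simp: \<O>_def)
    qed
  qed
  then obtain E where E: "E \<in> \<O>" and max: "\<And>X. X \<in> \<O> \<Longrightarrow> E \<subseteq> X \<Longrightarrow> X = E" by blast
  have span: "closure (chilbert.span E) = UNIV"
  proof (rule ccontr)
    assume "closure (chilbert.span E) \<noteq> UNIV"
    then obtain x where "x \<notin> closure (chilbert.span E)" by blast
    then obtain z where z: "z \<noteq> 0" "\<And>y. y \<in> closure (chilbert.span E) \<Longrightarrow> cinner y z = 0"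
      using orthogonal_complement_nontrivial[OF subspace_closure closed_closure]
      by (metis chilbert.subspace_span)
    define w where "w = of_real (1 / norm z) *\<^sub>C z"
    have w: "cinner w w = 1"
    proof -
      have "norm w = 1" using z(1) by (simp add: w_def norm_scaleC norm_divide)
      then show ?thesis by (simp add: cinner_same)
    qed
    have ew: "cinner e w = 0" if "e \<in> E" for e
      using z(2)[of e] that closure_subset chilbert.span_base[OF that]
      by (auto simp: w_def cinner_scaleC_right)
    then have "insert w E \<in> \<O>"
      using E w by (auto simp: \<O>_def cinner_eq_0_commute[of w])
    then have "w \<in> E" using max by blast
    then show False using ew[of w] w by simp
  qed
  have "\<forall>e\<in>E. \<forall>f\<in>E. cinner e f = (if e = f then 1 else 0)" using E unfolding \<O>_def by (rule CollectD)
  then show ?thesis using span unfolding orthonormal_basis_def by blast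
qed

lemma norm_sum_orthonormal:
  assumes "finite F" "\<And>e f. e \<in> F \<Longrightarrow> f \<in> F \<Longrightarrow> cinner e f = (if e = f then 1 else 0)"
  shows "(norm (\<Sum>e\<in>F. c e *\<^sub>C e))\<^sup>2 = (\<Sum>e\<in>F. (cmod (c e))\<^sup>2)"
proof -
  have "complex_of_real ((norm (\<Sum>e\<in>F. c e *\<^sub>C e))\<^sup>2) = (\<Sum>e\<in>F. \<Sum>f\<in>F. cnj (c e) * c f * cinner e f)"
    unfolding power2_norm_eq_cinner cinner_sum_left unfolding cinner_sum_right
    by (simp add: cinner_scaleC_left cinner_scaleC_right mult_ac)
  also have "\<dots> = (\<Sum>e\<in>F. \<Sum>f\<in>F. if e = f then cnj (c e) * c f else 0)"
    by (intro sum.cong refl) (simp add: assms(2))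
  also have "\<dots> = (\<Sum>e\<in>F. c e * cnj (c e))" using assms(1) by (simp add: mult.commute)
  also have "\<dots> = of_real (\<Sum>e\<in>F. (cmod (c e))\<^sup>2)"
    unfolding of_real_sum complex_norm_square ..
  finally show ?thesis by (simp only: of_real_eq_iff)
qed

text \<open>The residual \<open>r\<close> is orthogonal to all of \<open>F\<close>, and passing to
  other coefficients adds a vector \<open>w\<close> from the span of \<open>F\<close>; Pythagoras
  does the rest.\<close>

lemma orthonormal_best_approximation:
  assumes "finite F" "\<And>e f. e \<in> F \<Longrightarrow> f \<in> F \<Longrightarrow> cinner e f = (if e = f then 1 else 0)"
  shows "norm (x - (\<Sum>e\<in>F. cinner e x *\<^sub>C e)) \<le> norm (x - (\<Sum>e\<in>F. c e *\<^sub>C e))"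
proof -
  define r where "r = x - (\<Sum>e\<in>F. cinner e x *\<^sub>C e)"
  define w where "w = (\<Sum>e\<in>F. (cinner e x - c e) *\<^sub>C e)"
  have "cinner e r = 0" if "e \<in> F" for e
  proof -
    have "cinner e (\<Sum>f\<in>F. cinner f x *\<^sub>C f) = (\<Sum>f\<in>F. if e = f then cinner f x else 0)"
      unfolding cinner_sum_right cinner_scaleC_right
      by (intro sum.cong refl) (use that in \<open>simp add: assms(2)\<close>)
    also have "\<dots> = cinner e x" using assms(1) that by simp
    finally show ?thesis by (simp add: r_def cinner_diff_right)
  qed
  then have "cinner w r = 0" by (simp add: w_def cinner_sum_left cinner_scaleC_left)
  then have "cinner r w = 0" using cinner_eq_0_commute by blast
  then have "(norm r)\<^sup>2 \<le> (norm (r + w))\<^sup>2" by (simp add: norm_add_square)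
  moreover have "r + w = x - (\<Sum>e\<in>F. c e *\<^sub>C e)"
    by (simp add: r_def w_def chilbert.scale_left_diff_distrib sum_subtractf)
  ultimately show ?thesis unfolding r_def[symmetric] by (metis norm_ge_zero power2_le_imp_le)
qed

text \<open>Density supplies a good approximation with finite support \<open>G\<close>. Padded with
  zero coefficients it competes on every finite \<open>F\<close> containing \<open>G\<close>, where
  the Fourier coefficients are optimal.\<close>

lemma orthonormal_basis_expansion:
  assumes E: "orthonormal_basis E"
  shows "((\<lambda>e. cinner e x *\<^sub>C e) has_sum x) E"
  unfolding has_sum_def tendsto_iff
proof (intro allI impI)
  fix \<epsilon> :: real assume "\<epsilon> > 0"
  have on: "\<And>e f. e \<in> E \<Longrightarrow> f \<in> E \<Longrightarrow> cinner e f = (if e = f then 1 else 0)"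
    using E by (auto simp: orthonormal_basis_def)
  have "x \<in> closure (chilbert.span E)" using E by (simp add: orthonormal_basis_def)
  then obtain w where w: "w \<in> chilbert.span E" "dist w x < \<epsilon>"
    using \<open>\<epsilon> > 0\<close> by (meson closure_approachable)
  then obtain G c where G: "finite G" "G \<subseteq> E" and wG: "w = (\<Sum>e\<in>G. c e *\<^sub>C e)"
    unfolding chilbert.span_explicit by blast
  show "\<forall>\<^sub>F F in finite_subsets_at_top E. dist (\<Sum>e\<in>F. cinner e x *\<^sub>C e) x < \<epsilon>"
    unfolding eventually_finite_subsets_at_top
  proof (intro exI[of _ G] conjI allI impI G)
    fix F assume F: "finite F \<and> G \<subseteq> F \<and> F \<subseteq> E"
    have "w = (\<Sum>e\<in>F. (if e \<in> G then c e else 0) *\<^sub>C e)"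
      unfolding wG by (rule sum.mono_neutral_cong_left) (use F in auto)
    moreover have "norm (x - (\<Sum>e\<in>F. cinner e x *\<^sub>C e))
        \<le> norm (x - (\<Sum>e\<in>F. (if e \<in> G then c e else 0) *\<^sub>C e))"
      using F on by (intro orthonormal_best_approximation) blast+
    ultimately show "dist (\<Sum>e\<in>F. cinner e x *\<^sub>C e) x < \<epsilon>"
      using w(2) by (simp add: dist_norm norm_minus_commute)
  qed
qed

lemma has_sum_cinner:
  assumes "orthonormal_basis E"
  shows "((\<lambda>e. cinner x e * cinner e y) has_sum cinner x y) E"
  using has_sum_bounded_linear[OF bounded_linear_cinner_right orthonormal_basis_expansion[OF assms], of x y]
  by (simp add: cinner_scaleC_right mult.commute)

lemma has_sum_cmod_cinner_square:
  assumes "orthonormal_basis E"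
  shows "((\<lambda>e. (cmod (cinner x e))\<^sup>2) has_sum (norm x)\<^sup>2) E"
proof -
  have "cinner x e * cinner e x = of_real ((cmod (cinner x e))\<^sup>2)" for e
    unfolding complex_norm_square using cinner_commute[of e x] by simp
  then show ?thesis
    using has_sum_cinner[OF assms, of x x] unfolding power2_norm_eq_cinner[symmetric]
    by (simp only: has_sum_of_real_iff)
qed

lemma has_sum_sum:
  fixes f :: "'i \<Rightarrow> 'e \<Rightarrow> 'v::topological_comm_monoid_add"
  assumes "\<And>i. i \<in> I \<Longrightarrow> (f i has_sum s i) E"
  shows "((\<lambda>e. \<Sum>i\<in>I. f i e) has_sum (\<Sum>i\<in>I. s i)) E"
  using assms by (induction I rule: infinite_finite_induct) (simp_all add: has_sum_add)

section \<open>Tensor products of bounded operators\<close>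

text \<open>A vector has many representations as a combination of product vectors, so the operator
  to be extended is given as a relation. The bound applied to differences makes the relation and its
  closure single-valued, which yields well-definedness and continuity together.\<close>

lemma bounded_op_extension:
  fixes \<Gamma> :: "'b::chilbert_space \<Rightarrow> 'b \<Rightarrow> bool"
  assumes add: "\<And>v w v' w'. \<Gamma> v w \<Longrightarrow> \<Gamma> v' w' \<Longrightarrow> \<Gamma> (v + v') (w + w')"
    and scale: "\<And>c v w. \<Gamma> v w \<Longrightarrow> \<Gamma> (c *\<^sub>C v) (c *\<^sub>C w)"
    and bound: "\<And>v w. \<Gamma> v w \<Longrightarrow> norm w \<le> K * norm v"
    and dense: "closure {v. \<exists>w. \<Gamma> v w} = UNIV"
  obtains B where "bounded_op UNIV B" "\<And>v w. \<Gamma> v w \<Longrightarrow> B v = w"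
proof -
  \<comment> \<open>The closure of the graph, by sequences.\<close>
  define C where "C v w \<longleftrightarrow> (\<exists>f g. (\<forall>n. \<Gamma> (f n) (g n)) \<and> f \<longlonglongrightarrow> v \<and> g \<longlonglongrightarrow> w)" for v w
  have C_add: "C (v + v') (w + w')" if C: "C v w" "C v' w'" for v w v' w'
  proof -
    obtain f g f' g' where "\<forall>n. \<Gamma> (f n) (g n)" "f \<longlonglongrightarrow> v" "g \<longlonglongrightarrow> w"
      "\<forall>n. \<Gamma> (f' n) (g' n)" "f' \<longlonglongrightarrow> v'" "g' \<longlonglongrightarrow> w'"
      using C unfolding C_def by blast
    then show ?thesis unfolding C_def
      by (intro exI[of _ "\<lambda>n. f n + f' n"] exI[of _ "\<lambda>n. g n + g' n"]) (auto intro: add tendsto_add)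
  qed
  have C_scale: "C (c *\<^sub>C v) (c *\<^sub>C w)" if C: "C v w" for c v w
  proof -
    obtain f g where "\<forall>n. \<Gamma> (f n) (g n)" "f \<longlonglongrightarrow> v" "g \<longlonglongrightarrow> w" using C unfolding C_def by blast
    then show ?thesis unfolding C_def
      by (intro exI[of _ "\<lambda>n. c *\<^sub>C f n"] exI[of _ "\<lambda>n. c *\<^sub>C g n"])
        (auto intro: scale bounded_linear.tendsto[OF bounded_linear_scaleC_right])
  qed
  have C_bound: "norm w \<le> K * norm v" if C: "C v w" for v w
  proof -
    obtain f g where fg: "\<forall>n. \<Gamma> (f n) (g n)" "f \<longlonglongrightarrow> v" "g \<longlonglongrightarrow> w" using C unfolding C_def by blast
    show ?thesis
      by (rule LIMSEQ_le[OF tendsto_norm[OF fg(3)] tendsto_mult_left[OF tendsto_norm[OF fg(2)]]])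
        (use fg(1) bound in blast)
  qed
  have diff: "\<Gamma> (v - v') (w - w')" if "\<Gamma> v w" "\<Gamma> v' w'" for v w v' w'
    using add[OF that(1) scale[OF that(2), of "- 1"]] by simp
  have C_ex: "\<exists>w. C v w" for v
  proof -
    have "v \<in> closure {v. \<exists>w. \<Gamma> v w}" using dense by simp
    then obtain f where f: "\<forall>n. \<exists>w. \<Gamma> (f n) w" "f \<longlonglongrightarrow> v" unfolding closure_sequential by blast
    then obtain g where g: "\<forall>n. \<Gamma> (f n) (g n)" by metis
    have "Cauchy g"
    proof (rule metric_CauchyI)
      fix e :: real assume "e > 0"
      \<comment> \<open>\<open>K\<close> may be zero or negative; a positive bound is needed to
        divide \<open>e\<close> by it.\<close>
      define L where "L = \<bar>K\<bar> + 1"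
      have "L > 0" by (simp add: L_def)
      then have "e / L > 0" using \<open>e > 0\<close> by simp
      then obtain M where M: "\<forall>m\<ge>M. \<forall>n\<ge>M. dist (f m) (f n) < e / L"
        using LIMSEQ_imp_Cauchy[OF f(2)] unfolding Cauchy_def by blast
      have "dist (g m) (g n) < e" if "m \<ge> M" "n \<ge> M" for m n
      proof -
        have "dist (g m) (g n) \<le> K * dist (f m) (f n)"
          using bound diff g by (simp add: dist_norm)
        also have "\<dots> \<le> L * dist (f m) (f n)" by (intro mult_right_mono) (auto simp: L_def)
        also have "\<dots> < L * (e / L)" using M that \<open>L > 0\<close> by (intro mult_strict_left_mono) auto
        finally show ?thesis using \<open>L > 0\<close> by simp
      qed
      then show "\<exists>M. \<forall>m\<ge>M. \<forall>n\<ge>M. dist (g m) (g n) < e" by blast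
    qed
    then obtain w where "g \<longlonglongrightarrow> w" using Cauchy_convergent_iff convergent_def by blast
    then show ?thesis using f(2) g unfolding C_def by blast
  qed
  have C_unique: "w = w'" if "C v w" "C v w'" for v w w'
    using C_bound[OF C_add[OF that(1) C_scale[OF that(2), of "- 1"]]] by simp
  define B where "B v = (SOME w. C v w)" for v
  have CB: "C v (B v)" for v unfolding B_def using C_ex by (rule someI_ex)
  have "bounded_op UNIV B"
    unfolding bounded_op_def
    using C_unique[OF CB C_add[OF CB CB]] C_unique[OF CB C_scale[OF CB]] C_bound[OF CB] by blast
  moreover have "B v = w" if "\<Gamma> v w" for v w
  proof -
    have "C v w" unfolding C_def using that
      by (intro exI[of _ "\<lambda>_. v"] exI[of _ "\<lambda>_. w"]) simp
    then show ?thesis using C_unique CB by blast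
  qed
  ultimately show ?thesis using that by blast
qed

lemma bounded_op_comp: "bounded_op UNIV B \<Longrightarrow> bounded_op UNIV B' \<Longrightarrow> bounded_op UNIV (B \<circ> B')"
proof -
  assume B: "bounded_op UNIV B" and B': "bounded_op UNIV B'"
  obtain K where K: "K \<ge> 0" "\<And>x. norm (B x) \<le> K * norm x" using bounded_op_bound[OF B] by auto
  obtain K' where K': "\<And>x. norm (B' x) \<le> K' * norm x" using bounded_op_bound[OF B'] by auto
  have "norm (B (B' x)) \<le> (K * K') * norm x" for x
    using order_trans[OF K(2) mult_left_mono[OF K' K(1)]] by (simp add: mult.assoc)
  then show ?thesis using B B' unfolding bounded_op_def by (auto intro!: exI[of _ "K * K'"])
qed

lemma bounded_op_imp_bounded_linear:
  assumes "bounded_op UNIV B"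
  shows "bounded_linear B"
proof -
  obtain K where K: "\<And>x. norm (B x) \<le> K * norm x" using bounded_op_bound[OF assms] by auto
  show ?thesis
  proof (rule bounded_linear_intro)
    show "B (r *\<^sub>R x) = r *\<^sub>R B x" for r x
      using bounded_op_scaleC[OF assms, of x "of_real r"] by (simp add: scaleC_of_real)
    show "norm (B x) \<le> norm x * K" for x using K[of x] by (simp add: mult.commute)
  qed (simp add: bounded_op_add[OF assms])
qed

lemma bounded_op_eqI:
  assumes B: "bounded_op UNIV B" and B': "bounded_op UNIV B'"
    and dense: "closure (module.span scaleC X) = UNIV" and eq: "\<And>x. x \<in> X \<Longrightarrow> B x = B' x"
  shows "B = B'"
proof
  fix x
  have "module.subspace scaleC {x. B x = B' x}"
  proof (rule chilbert.subspaceI)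
    show "0 \<in> {x. B x = B' x}" using bounded_op_scaleC[OF B, of 0 0] bounded_op_scaleC[OF B', of 0 0] by simp
  qed (simp_all add: bounded_op_add[OF B] bounded_op_add[OF B'] bounded_op_scaleC[OF B] bounded_op_scaleC[OF B'])
  then have "chilbert.span X \<subseteq> {x. B x = B' x}" using eq by (intro chilbert.span_minimal) auto
  moreover have "closed {x. B x = B' x}"
    using B B' by (intro closed_Collect_eq linear_continuous_on bounded_op_imp_bounded_linear)
  ultimately have "closure (chilbert.span X) \<subseteq> {x. B x = B' x}" by (rule closure_minimal)
  then show "B x = B' x" using dense by auto
qed

text \<open>Brings two combinations to a common index set; on the overlap the coefficients add
  up.\<close>

lemma sum_scaleC_Un:
  fixes f :: "'i \<Rightarrow> 'b::chilbert_space"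
  assumes "finite I" "finite J"
  shows "(\<Sum>x\<in>I \<union> J. ((if x \<in> I then c x else 0) + (if x \<in> J then d x else 0)) *\<^sub>C f x)
    = (\<Sum>x\<in>I. c x *\<^sub>C f x) + (\<Sum>x\<in>J. d x *\<^sub>C f x)"
proof -
  have "(\<Sum>x\<in>I. c x *\<^sub>C f x) = (\<Sum>x\<in>I \<union> J. (if x \<in> I then c x else 0) *\<^sub>C f x)"
    by (rule sum.mono_neutral_cong_left) (use assms in auto)
  moreover have "(\<Sum>x\<in>J. d x *\<^sub>C f x) = (\<Sum>x\<in>I \<union> J. (if x \<in> J then d x else 0) *\<^sub>C f x)"
    by (rule sum.mono_neutral_cong_left) (use assms in auto)
  ultimately show ?thesis by (simp add: scaleC_add_left sum.distrib)
qed

context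
  fixes N :: nat and H :: "nat \<Rightarrow> 'a::chilbert_space set" and \<tau> :: "(nat \<Rightarrow> 'a) \<Rightarrow> 'b::chilbert_space"
  assumes subspace: "\<And>n. n \<in> {1..N} \<Longrightarrow> module.subspace scaleC (H n)"
    and tensor: "hilbert_tensor_product N H \<tau>"
begin

abbreviation "\<Pi>H \<equiv> \<Pi>\<^sub>E n\<in>{1..N}. H n"

lemma tensor_cinner: "x \<in> \<Pi>H \<Longrightarrow> y \<in> \<Pi>H \<Longrightarrow> cinner (\<tau> x) (\<tau> y) = (\<Prod>n=1..N. cinner (x n) (y n))"
  and tensor_dense: "closure (module.span scaleC (\<tau> ` \<Pi>H)) = UNIV"
  using tensor by (simp_all add: hilbert_tensor_product_def)

lemma fun_upd_in: "x \<in> \<Pi>H \<Longrightarrow> n \<in> {1..N} \<Longrightarrow> u \<in> H n \<Longrightarrow> x(n := u) \<in> \<Pi>H"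
  by (auto simp: PiE_iff extensional_def)

text \<open>The unit vector \<open>u\<close> fills slot \<open>n\<close>, so the product over the
  other sites is again an inner product of vectors of \<open>'b\<close>, and no tensor product of
  the remaining sites has to be formed.\<close>

lemma tensor_cinner_upd:
  assumes "x \<in> \<Pi>H" "y \<in> \<Pi>H" "n \<in> {1..N}" "a \<in> H n" "b \<in> H n" "u \<in> H n" "cinner u u = 1"
  shows "cinner (\<tau> (x(n := a))) (\<tau> (y(n := b))) = cinner a b * cinner (\<tau> (x(n := u))) (\<tau> (y(n := u)))"
proof -
  have *: "cinner (\<tau> (x(n := a))) (\<tau> (y(n := b))) = cinner a b * (\<Prod>k\<in>{1..N} - {n}. cinner (x k) (y k))"
    if "a \<in> H n" "b \<in> H n" for a b
  proof -
    have "cinner (\<tau> (x(n := a))) (\<tau> (y(n := b))) = (\<Prod>k=1..N. cinner ((x(n := a)) k) ((y(n := b)) k))"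
      using assms that by (intro tensor_cinner fun_upd_in)
    also have "\<dots> = cinner a b * (\<Prod>k\<in>{1..N} - {n}. cinner ((x(n := a)) k) ((y(n := b)) k))"
      using assms(3) by (subst prod.remove[of _ n]) auto
    also have "(\<Prod>k\<in>{1..N} - {n}. cinner ((x(n := a)) k) ((y(n := b)) k))
        = (\<Prod>k\<in>{1..N} - {n}. cinner (x k) (y k))"
      by (intro prod.cong) auto
    finally show ?thesis .
  qed
  show ?thesis using *[of a b] *[of u u] assms by simp
qed

text \<open>
  The Gram matrix of the vectors \<open>\<tau> (x(n := f x))\<close> is the entrywise product of that of the \<open>f x\<close> and
  that of the \<open>\<tau> (x(n := u))\<close>. Expanding the latter in \<open>E\<close> turns the squared norm of a sum of product
  vectors into a sum of squared norms in \<open>H n\<close>, where the bound on an operator on \<open>H n\<close> applies termwise.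
\<close>

lemma has_sum_norm_tensor:
  assumes E: "orthonormal_basis E" and n: "n \<in> {1..N}" and u: "u \<in> H n" "cinner u u = 1"
    and I: "finite I" "I \<subseteq> \<Pi>H" and f: "\<And>x. x \<in> I \<Longrightarrow> f x \<in> H n"
  shows "((\<lambda>e. (norm (\<Sum>x\<in>I. (c x * cinner e (\<tau> (x(n := u)))) *\<^sub>C f x))\<^sup>2)
    has_sum (norm (\<Sum>x\<in>I. c x *\<^sub>C \<tau> (x(n := f x))))\<^sup>2) E"
proof -
  define w where "w x = \<tau> (x(n := u))" for x
  have total: "(\<Sum>x\<in>I. \<Sum>y\<in>I. cnj (c x) * c y * cinner (f x) (f y) * cinner (w x) (w y))
      = complex_of_real ((norm (\<Sum>x\<in>I. c x *\<^sub>C \<tau> (x(n := f x))))\<^sup>2)"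
    unfolding power2_norm_eq_cinner cinner_sum_left unfolding cinner_sum_right
  proof (intro sum.cong refl)
    fix x y assume "x \<in> I" "y \<in> I"
    then have "cinner (\<tau> (x(n := f x))) (\<tau> (y(n := f y))) = cinner (f x) (f y) * cinner (w x) (w y)"
      unfolding w_def using I n u f by (intro tensor_cinner_upd) auto
    then show "cnj (c x) * c y * cinner (f x) (f y) * cinner (w x) (w y)
        = cinner (c x *\<^sub>C \<tau> (x(n := f x))) (c y *\<^sub>C \<tau> (y(n := f y)))"
      by (simp add: cinner_scaleC_left cinner_scaleC_right)
  qed
  have part: "(\<Sum>x\<in>I. \<Sum>y\<in>I. cnj (c x) * c y * cinner (f x) (f y) * (cinner (w x) e * cinner e (w y)))
      = complex_of_real ((norm (\<Sum>x\<in>I. (c x * cinner e (w x)) *\<^sub>C f x))\<^sup>2)" for e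
    unfolding power2_norm_eq_cinner cinner_sum_left unfolding cinner_sum_right
    by (intro sum.cong refl)
      (simp add: cinner_scaleC_left cinner_scaleC_right mult_ac cinner_commute[of "w _" e])
  have "((\<lambda>e. \<Sum>x\<in>I. \<Sum>y\<in>I. cnj (c x) * c y * cinner (f x) (f y) * (cinner (w x) e * cinner e (w y)))
      has_sum (\<Sum>x\<in>I. \<Sum>y\<in>I. cnj (c x) * c y * cinner (f x) (f y) * cinner (w x) (w y))) E"
    by (intro has_sum_sum has_sum_cmult_right has_sum_cinner E)
  then show ?thesis unfolding total part has_sum_of_real_iff unfolding w_def .
qed

lemma tensor_site_op_bound:
  assumes n: "n \<in> {1..N}" and A: "bounded_op (H n) A"
    and K: "K \<ge> 0" "\<And>v. v \<in> H n \<Longrightarrow> norm (A v) \<le> K * norm v"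
    and I: "finite I" "I \<subseteq> \<Pi>H"
  shows "norm (\<Sum>x\<in>I. c x *\<^sub>C \<tau> (x(n := A (x n)))) \<le> K * norm (\<Sum>x\<in>I. c x *\<^sub>C \<tau> x)"
proof (cases "H n \<subseteq> {0}")
  \<comment> \<open>There is no unit vector to put into slot \<open>n\<close>, but a product vector
    with a zero entry vanishes by homogeneity in that entry.\<close>
  case True
  have "\<tau> (x(n := A (x n))) = 0" if "x \<in> I" for x
  proof -
    have x: "x \<in> \<Pi>H" "x n \<in> H n" using subsetD[OF I(2) that] PiE_mem n by blast+
    then have "A (x n) = 0" "0 \<in> H n" using True bounded_op_in[OF A] by auto
    moreover have "\<tau> (x(n := 0 *\<^sub>C 0)) = 0 *\<^sub>C \<tau> (x(n := 0))"
      using tensor x n \<open>0 \<in> H n\<close> unfolding hilbert_tensor_product_def by blast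
    ultimately show ?thesis by simp
  qed
  then have "(\<Sum>x\<in>I. c x *\<^sub>C \<tau> (x(n := A (x n)))) = 0" by simp
  then show ?thesis using K(1) by simp
next
  case False
  then obtain u0 where u0: "u0 \<in> H n" "u0 \<noteq> 0" by blast
  define u where "u = of_real (1 / norm u0) *\<^sub>C u0"
  have uH: "u \<in> H n" unfolding u_def using chilbert.subspace_scale[OF subspace[OF n] u0(1)] .
  have "norm u = 1" using u0(2) by (simp add: u_def norm_scaleC norm_divide)
  then have uu: "cinner u u = 1" by (simp add: cinner_same)
  obtain E :: "'b set" where E: "orthonormal_basis E" using orthonormal_basis_exists by blast
  have xn: "x n \<in> H n" if "x \<in> I" for x using PiE_mem[OF subsetD[OF I(2) that] n] .
  define a where "a e = (\<lambda>x. c x * cinner e (\<tau> (x(n := u))))" for e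
  have 1: "((\<lambda>e. (norm (\<Sum>x\<in>I. a e x *\<^sub>C A (x n)))\<^sup>2)
      has_sum (norm (\<Sum>x\<in>I. c x *\<^sub>C \<tau> (x(n := A (x n)))))\<^sup>2) E"
    unfolding a_def by (rule has_sum_norm_tensor[OF E n uH uu I]) (rule bounded_op_in[OF A xn])
  \<comment> \<open>For \<open>f x = x n\<close> the update at \<open>n\<close> is void, so the same
    identity computes the norm of the original combination, with the same coefficients
    \<open>a e\<close>.\<close>
  have 2: "((\<lambda>e. (norm (\<Sum>x\<in>I. a e x *\<^sub>C x n))\<^sup>2) has_sum (norm (\<Sum>x\<in>I. c x *\<^sub>C \<tau> x))\<^sup>2) E"
    using has_sum_norm_tensor[OF E n uH uu I, of "\<lambda>x. x n" c] xn by (simp add: a_def)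
  have "(norm (\<Sum>x\<in>I. a e x *\<^sub>C A (x n)))\<^sup>2 \<le> K\<^sup>2 * (norm (\<Sum>x\<in>I. a e x *\<^sub>C x n))\<^sup>2" for e
  proof -
    have "(\<Sum>x\<in>I. a e x *\<^sub>C x n) \<in> H n"
      by (rule chilbert.subspace_sum[OF subspace[OF n] chilbert.subspace_scale[OF subspace[OF n] xn]])
    then have "norm (A (\<Sum>x\<in>I. a e x *\<^sub>C x n)) \<le> K * norm (\<Sum>x\<in>I. a e x *\<^sub>C x n)" by (rule K(2))
    moreover have "A (\<Sum>x\<in>I. a e x *\<^sub>C x n) = (\<Sum>x\<in>I. a e x *\<^sub>C A (x n))"
      by (rule bounded_op_sum[OF A subspace[OF n] xn])
    ultimately have "norm (\<Sum>x\<in>I. a e x *\<^sub>C A (x n)) \<le> K * norm (\<Sum>x\<in>I. a e x *\<^sub>C x n)" by (simp only:)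
    from power_mono[OF this norm_ge_zero, of 2] show ?thesis by (simp only: power_mult_distrib)
  qed
  then have "(norm (\<Sum>x\<in>I. c x *\<^sub>C \<tau> (x(n := A (x n)))))\<^sup>2 \<le> K\<^sup>2 * (norm (\<Sum>x\<in>I. c x *\<^sub>C \<tau> x))\<^sup>2"
    by (intro has_sum_mono[OF 1 has_sum_cmult_right[OF 2]])
  then show ?thesis unfolding power_mult_distrib[symmetric]
    by (rule power2_le_imp_le) (intro mult_nonneg_nonneg K(1) norm_ge_zero)
qed

lemma tensor_site_op:
  assumes n: "n \<in> {1..N}" and A: "bounded_op (H n) A"
  obtains B where "bounded_op UNIV B" "\<And>x. x \<in> \<Pi>H \<Longrightarrow> B (\<tau> x) = \<tau> (x(n := A (x n)))"
proof -
  obtain K where K: "K \<ge> 0" "\<And>v. v \<in> H n \<Longrightarrow> norm (A v) \<le> K * norm v"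
    using bounded_op_bound[OF A] by blast
  define \<sigma> where "\<sigma> x = \<tau> (x(n := A (x n)))" for x
  define \<Gamma> where "\<Gamma> v w \<longleftrightarrow> (\<exists>I c. finite I \<and> I \<subseteq> \<Pi>H \<and>
    v = (\<Sum>x\<in>I. c x *\<^sub>C \<tau> x) \<and> w = (\<Sum>x\<in>I. c x *\<^sub>C \<sigma> x))" for v w
  have \<Gamma>I: "\<Gamma> (\<Sum>x\<in>I. c x *\<^sub>C \<tau> x) (\<Sum>x\<in>I. c x *\<^sub>C \<sigma> x)" if "finite I" "I \<subseteq> \<Pi>H" for I c
    using that unfolding \<Gamma>_def by blast
  obtain B where B: "bounded_op UNIV B" "\<And>v w. \<Gamma> v w \<Longrightarrow> B v = w"
  proof (rule bounded_op_extension[of \<Gamma> K])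
    fix v w v' w' assume "\<Gamma> v w" "\<Gamma> v' w'"
    then obtain I c J d where "finite I" "I \<subseteq> \<Pi>H" "finite J" "J \<subseteq> \<Pi>H"
      and eq: "v = (\<Sum>x\<in>I. c x *\<^sub>C \<tau> x)" "w = (\<Sum>x\<in>I. c x *\<^sub>C \<sigma> x)"
        "v' = (\<Sum>x\<in>J. d x *\<^sub>C \<tau> x)" "w' = (\<Sum>x\<in>J. d x *\<^sub>C \<sigma> x)"
      unfolding \<Gamma>_def by blast
    then show "\<Gamma> (v + v') (w + w')"
      using \<Gamma>I[of "I \<union> J" "\<lambda>x. (if x \<in> I then c x else 0) + (if x \<in> J then d x else 0)"]
      by (simp add: eq sum_scaleC_Un)
  next
    fix a v w assume "\<Gamma> v w"
    then obtain I c where "finite I" "I \<subseteq> \<Pi>H"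
      and eq: "v = (\<Sum>x\<in>I. c x *\<^sub>C \<tau> x)" "w = (\<Sum>x\<in>I. c x *\<^sub>C \<sigma> x)"
      unfolding \<Gamma>_def by blast
    then show "\<Gamma> (a *\<^sub>C v) (a *\<^sub>C w)"
      using \<Gamma>I[of I "\<lambda>x. a * c x"] by (simp add: chilbert.scale_sum_right)
  next
    fix v w assume "\<Gamma> v w"
    then show "norm w \<le> K * norm v"
      unfolding \<Gamma>_def \<sigma>_def using tensor_site_op_bound[OF n A K] by blast
  next
    have "chilbert.span (\<tau> ` \<Pi>H) \<subseteq> {v. \<exists>w. \<Gamma> v w}"
    proof
      fix v assume "v \<in> chilbert.span (\<tau> ` \<Pi>H)"
      then obtain t r where t: "finite t" "t \<subseteq> \<tau> ` \<Pi>H" and v: "v = (\<Sum>a\<in>t. r a *\<^sub>C a)"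
        unfolding chilbert.span_explicit by blast
      \<comment> \<open>\<open>\<tau>\<close> is not injective in general, since scalars can be
        moved between sites. One preimage for each vector of \<open>t\<close> is selected, so that
        the sum can be reindexed.\<close>
      obtain I where I: "I \<subseteq> \<Pi>H" "inj_on \<tau> I" "t = \<tau> ` I"
        using t(2) unfolding subset_image_inj by blast
      then have "finite I" using t(1) finite_image_iff by blast
      moreover have "v = (\<Sum>x\<in>I. r (\<tau> x) *\<^sub>C \<tau> x)" unfolding v I(3) using I(2) by (simp add: sum.reindex)
      ultimately show "v \<in> {v. \<exists>w. \<Gamma> v w}" using \<Gamma>I[of I "\<lambda>x. r (\<tau> x)"] I(1) by blast
    qed
    then show "closure {v. \<exists>w. \<Gamma> v w} = UNIV" using tensor_dense closure_mono by blast
  qed blast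
  have "B (\<tau> x) = \<sigma> x" if "x \<in> \<Pi>H" for x
    using B(2)[OF \<Gamma>I[of "{x}" "\<lambda>_. 1"]] that by simp
  then show ?thesis using that B(1) by (simp add: \<sigma>_def)
qed

text \<open>The operator is a composition of one-site operators, and density of the span of the
  product vectors makes it unique. Hence the description behind \<open>tensor_op\<close> has a
  solution and denotes it.\<close>

lemma bounded_op_tensor_op:
  assumes A: "\<And>n. n \<in> {1..N} \<Longrightarrow> bounded_op (H n) (A n)"
  shows "bounded_op UNIV (tensor_op N H \<tau> A)"
proof -
  \<comment> \<open>The entries after \<open>A\<close> has been applied at the sites up to
    \<open>k\<close>: \<open>k = 0\<close> is the identity and \<open>k = N\<close> the full
    product.\<close>
  define R where "R k x = (\<lambda>n\<in>{1..N}. if n \<le> k then A n (x n) else x n)" for k :: nat and x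
  have R_in: "R k x \<in> \<Pi>H" if "x \<in> \<Pi>H" for k x
  proof (rule PiE_I)
    fix n assume n: "n \<in> {1..N}"
    have "x n \<in> H n" by (rule PiE_mem[OF that n])
    moreover from this have "A n (x n) \<in> H n" by (rule bounded_op_in[OF A[OF n]])
    ultimately show "R k x n \<in> H n" using n by (simp add: R_def)
  qed (simp only: R_def restrict_def if_False)
  have R_0: "R 0 x = x" if x: "x \<in> \<Pi>H" for x
  proof
    show "R 0 x n = x n" for n
    proof (cases "n \<in> {1..N}")
      case True
      then have "\<not> n \<le> 0" by simp
      with True show ?thesis by (simp only: R_def restrict_def if_True if_False)
    next
      case False
      then show ?thesis using PiE_arb[OF x False] by (simp only: R_def restrict_def if_False)
    qed
  qed
  have R_Suc: "(R k x)(Suc k := A (Suc k) (R k x (Suc k))) = R (Suc k) x" if "Suc k \<in> {1..N}" for k x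
  proof
    show "((R k x)(Suc k := A (Suc k) (R k x (Suc k)))) n = R (Suc k) x n" for n
    proof (cases "n = Suc k")
      case True
      then show ?thesis using that by (simp add: R_def)
    next
      case False
      then have "n \<le> Suc k \<longleftrightarrow> n \<le> k" by linarith
      with False show ?thesis by (simp only: R_def restrict_def fun_upd_apply if_False)
    qed
  qed
  have R_N: "R N x = (\<lambda>n\<in>{1..N}. A n (x n))" for x
    unfolding R_def by (rule restrict_ext) simp
  have "\<exists>B. bounded_op UNIV B \<and> (\<forall>x\<in>\<Pi>H. B (\<tau> x) = \<tau> (R k x))" if "k \<le> N" for k
    using that
  proof (induction k)
    case 0
    show ?case by (intro exI[of _ "\<lambda>x. x"] conjI ballI bounded_op_id) (simp only: R_0)
  next
    case (Suc k)
    from Suc.IH[OF Suc_leD[OF Suc.prems]]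
    obtain B where B: "bounded_op UNIV B \<and> (\<forall>x\<in>\<Pi>H. B (\<tau> x) = \<tau> (R k x))" ..
    have k: "Suc k \<in> {1..N}" using Suc.prems by simp
    obtain B' where B': "bounded_op UNIV B'"
      "\<And>x. x \<in> \<Pi>H \<Longrightarrow> B' (\<tau> x) = \<tau> (x(Suc k := A (Suc k) (x (Suc k))))"
      by (rule tensor_site_op[OF k A[OF k]]) blast
    have "(B' \<circ> B) (\<tau> x) = \<tau> (R (Suc k) x)" if x: "x \<in> \<Pi>H" for x
      unfolding comp_apply bspec[OF conjunct2[OF B] x] B'(2)[OF R_in[OF x]] R_Suc[OF k] ..
    with bounded_op_comp[OF B'(1) conjunct1[OF B]] show ?case by (intro exI[of _ "B' \<circ> B"] conjI ballI)
  qed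
  from this[OF order_refl]
  obtain B where B: "bounded_op UNIV B \<and> (\<forall>x\<in>\<Pi>H. B (\<tau> x) = \<tau> (\<lambda>n\<in>{1..N}. A n (x n)))"
    unfolding R_N ..
  have "tensor_op N H \<tau> A = B"
    unfolding tensor_op_def
  proof (rule the_equality)
    show "bounded_op UNIV B \<and> (\<forall>x\<in>\<Pi>H. B (\<tau> x) = \<tau> (\<lambda>n\<in>{1..N}. A n (x n)))" by (rule B)
    fix C assume C: "bounded_op UNIV C \<and> (\<forall>x\<in>\<Pi>H. C (\<tau> x) = \<tau> (\<lambda>n\<in>{1..N}. A n (x n)))"
    show "C = B"
    proof (rule bounded_op_eqI[OF conjunct1[OF C] conjunct1[OF B] tensor_dense])
      fix y assume "y \<in> \<tau> ` \<Pi>H"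
      then obtain x where x: "x \<in> \<Pi>H" "y = \<tau> x" by blast
      show "C y = B y" unfolding x(2) bspec[OF conjunct2[OF B] x(1)] bspec[OF conjunct2[OF C] x(1)] ..
    qed
  qed
  then show ?thesis using B by simp
qed

end

section \<open>The trace\<close>

lemma cinner_mult_commute: "cinner u x * cinner x u = of_real ((cmod (cinner u x))\<^sup>2)"
  using cinner_commute[of x u] by (simp only: complex_norm_square)

text \<open>One step of a Cholesky decomposition: subtracting a rank-one operator from \<open>\<rho>\<close> kills \<open>h\<close>.\<close>

lemma positive_op_split_rank_one:
  fixes \<rho> :: "'b::chilbert_space \<Rightarrow> 'b"
  assumes \<rho>: "positive_op UNIV \<rho>" and h: "\<rho> h \<noteq> 0"
  obtains u \<rho>' where "positive_op UNIV \<rho>'"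
    "\<And>x. Re (cinner x (\<rho> x)) = (cmod (cinner u x))\<^sup>2 + Re (cinner x (\<rho>' x))"
    "\<rho>' h = 0" "\<And>x. \<rho> x = 0 \<Longrightarrow> \<rho>' x = 0"
proof -
  have bop: "bounded_op UNIV \<rho>" using \<rho> by (simp add: positive_op_def)
  note lin = bounded_op_add[OF bop UNIV_I UNIV_I] bounded_op_scaleC[OF bop UNIV_I]
  define b where "b = Re (cinner h (\<rho> h))"
  \<comment> \<open>If \<open>b\<close> were 0, Cauchy-Schwarz for the pair \<open>\<rho> h\<close>,
    \<open>h\<close> would force \<open>\<rho> h = 0\<close>.\<close>
  have "b \<noteq> 0"
  proof
    assume "b = 0"
    then have "(cmod (cinner (\<rho> h) (\<rho> h)))\<^sup>2 \<le> 0"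
      using positive_op_Cauchy_Schwarz[OF \<rho>, of "\<rho> h" h] by (simp add: b_def)
    then show False using h by (simp add: cinner_same)
  qed
  moreover have "b \<ge> 0" using \<rho> by (simp add: b_def positive_op_UNIV_iff)
  ultimately have b: "b > 0" by simp
  have hh: "cinner h (\<rho> h) = of_real b" using \<rho> by (simp add: b_def positive_op_UNIV_iff complex_eq_iff)
  \<comment> \<open>Normalized so that \<open>cmod (cinner u h)^2 = b\<close>, the whole diagonal
    entry at \<open>h\<close>. That the remainder is positive is then the Cauchy-Schwarz inequality
    for \<open>h\<close> and \<open>x\<close>.\<close>
  define u where "u = of_real (1 / sqrt b) *\<^sub>C \<rho> h"
  have ux: "cinner u x = of_real (1 / sqrt b) * cinner h (\<rho> x)" for x
    unfolding u_def cinner_scaleC_left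
    using cinner_commute[of "\<rho> h" x] positive_op_hermitian[OF \<rho>, of x h] by simp
  have ux_le: "(cmod (cinner u x))\<^sup>2 \<le> Re (cinner x (\<rho> x))" for x
  proof -
    have "(cmod (cinner u x))\<^sup>2 = (cmod (cinner h (\<rho> x)))\<^sup>2 / b"
      using b by (simp add: ux norm_mult norm_divide power_divide)
    also have "\<dots> \<le> Re (cinner x (\<rho> x))"
      using positive_op_Cauchy_Schwarz[OF \<rho>, of h x] b
      by (simp add: b_def pos_divide_le_eq mult.commute)
    finally show ?thesis .
  qed
  define \<rho>' where "\<rho>' x = \<rho> x - cinner u x *\<^sub>C u" for x
  have q: "cinner x (\<rho>' x) = cinner x (\<rho> x) - of_real ((cmod (cinner u x))\<^sup>2)" for x
    unfolding \<rho>'_def cinner_diff_right cinner_scaleC_right cinner_mult_commute ..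
  have "bounded_op UNIV \<rho>'"
  proof -
    obtain K where K: "\<And>x. norm (\<rho> x) \<le> K * norm x" using bounded_op_bound[OF bop] by auto
    have "norm (\<rho>' x) \<le> (K + norm u * norm u) * norm x" for x
    proof -
      have "norm (\<rho>' x) \<le> norm (\<rho> x) + cmod (cinner u x) * norm u"
        unfolding \<rho>'_def by (rule order_trans[OF norm_triangle_ineq4]) (simp add: norm_scaleC)
      also have "\<dots> \<le> K * norm x + (norm u * norm x) * norm u"
        by (intro add_mono K mult_right_mono cmod_cinner_le norm_ge_zero)
      finally show ?thesis by (simp add: algebra_simps)
    qed
    moreover have "\<rho>' (x + y) = \<rho>' x + \<rho>' y" "\<rho>' (c *\<^sub>C x) = c *\<^sub>C \<rho>' x" for x y c
      by (simp_all add: \<rho>'_def lin cinner_add_right cinner_scaleC_right scaleC_add_left scaleC_scaleC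
          chilbert.scale_right_diff_distrib)
    ultimately show ?thesis unfolding bounded_op_def by blast
  qed
  then have pos: "positive_op UNIV \<rho>'"
    using ux_le \<rho> unfolding positive_op_UNIV_iff q by simp
  have split: "Re (cinner x (\<rho> x)) = (cmod (cinner u x))\<^sup>2 + Re (cinner x (\<rho>' x))" for x
    by (simp add: q)
  have zero: "\<rho>' h = 0"
  proof -
    have "cinner u h *\<^sub>C u = (of_real (1 / sqrt b) * of_real b) *\<^sub>C u" unfolding ux hh ..
    also have "\<dots> = of_real (1 / sqrt b * b * (1 / sqrt b)) *\<^sub>C \<rho> h"
      unfolding u_def scaleC_scaleC by (simp only: of_real_mult)
    also have "1 / sqrt b * b * (1 / sqrt b) = 1" using b by (simp add: field_simps)
    finally show ?thesis by (simp add: \<rho>'_def)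
  qed
  have "\<rho>' x = 0" if "\<rho> x = 0" for x
    using that by (simp add: \<rho>'_def ux)
  with pos split zero show ?thesis by (rule that)
qed

text \<open>
  This is \<open>tr (G\<^sup>* \<rho> G) \<le> \<parallel>G\<parallel>\<^sup>2 tr \<rho>\<close> for the operator \<open>G\<close> with columns \<open>g i\<close>, proved without
  the square root of \<open>\<rho>\<close>: rank-one parts are split off until \<open>\<rho>\<close> vanishes on all \<open>g i\<close>.
\<close>

lemma sum_positive_op_le_trace:
  assumes E: "orthonormal_basis E" and F: "finite F" and C: "C \<ge> 0"
    and g: "\<And>u. (\<Sum>i\<in>F. (cmod (cinner u (g i)))\<^sup>2) \<le> C * (norm u)\<^sup>2"
    and "positive_op UNIV \<rho>" "((\<lambda>e. Re (cinner e (\<rho> e))) has_sum t) E"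
  shows "(\<Sum>i\<in>F. Re (cinner (g i) (\<rho> (g i)))) \<le> C * t"
  using assms(5,6)
proof (induction "card {i \<in> F. \<rho> (g i) \<noteq> 0}" arbitrary: \<rho> t rule: less_induct)
  case less
  show ?case
  proof (cases "\<exists>j\<in>F. \<rho> (g j) \<noteq> 0")
    case False
    have "t \<ge> 0" using less.prems by (intro has_sum_nonneg[OF less.prems(2)]) (simp add: positive_op_UNIV_iff)
    then show ?thesis using False C by simp
  next
    case True
    then obtain j where j: "j \<in> F" "\<rho> (g j) \<noteq> 0" by blast
    obtain u \<rho>' where \<rho>': "positive_op UNIV \<rho>'"
      and q: "\<And>x. Re (cinner x (\<rho> x)) = (cmod (cinner u x))\<^sup>2 + Re (cinner x (\<rho>' x))"
      and 0: "\<rho>' (g j) = 0" "\<And>x. \<rho> x = 0 \<Longrightarrow> \<rho>' x = 0"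
      by (rule positive_op_split_rank_one[OF less.prems(1) j(2)]) blast
    \<comment> \<open>The index \<open>j\<close> drops out and no other index enters, because every
      vector killed by \<open>\<rho>\<close> is killed by \<open>\<rho>'\<close>.\<close>
    have "{i \<in> F. \<rho>' (g i) \<noteq> 0} \<subset> {i \<in> F. \<rho> (g i) \<noteq> 0}" using 0 j by blast
    then have "card {i \<in> F. \<rho>' (g i) \<noteq> 0} < card {i \<in> F. \<rho> (g i) \<noteq> 0}"
      using F by (intro psubset_card_mono) simp_all
    moreover note \<rho>'
    \<comment> \<open>By Parseval the part split off has trace \<open>(norm u)^2\<close>. Its
      contribution to the left-hand side is bounded by \<open>C\<close> times this amount through
      the hypothesis on \<open>g\<close>.\<close>
    moreover have "((\<lambda>e. Re (cinner e (\<rho>' e))) has_sum (t - (norm u)\<^sup>2)) E"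
      using has_sum_add[OF less.prems(2) has_sum_cmult_right[OF has_sum_cmod_cinner_square[OF E, of u], of "- 1"]]
      by (simp add: q)
    ultimately have "(\<Sum>i\<in>F. Re (cinner (g i) (\<rho>' (g i)))) \<le> C * (t - (norm u)\<^sup>2)"
      by (rule less.hyps)
    then show ?thesis using g[of u] by (simp add: q sum.distrib right_diff_distrib)
  qed
qed

text \<open>Bessel's inequality for the adjoint of \<open>T\<close> at \<open>u\<close>, without the
  adjoint: \<open>w\<close> is the part of that vector along \<open>F\<close>. Its squared norm
  \<open>s\<close> equals \<open>cinner u (T w)\<close>, so \<open>s^2\<close> is at most
  \<open>K^2 * (norm u)^2 * s\<close>.\<close>

lemma sum_cmod_cinner_image_le:
  assumes T: "bounded_op UNIV T" and K: "K \<ge> 0" "\<And>x. norm (T x) \<le> K * norm x"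
    and F: "finite F" "\<And>e f. e \<in> F \<Longrightarrow> f \<in> F \<Longrightarrow> cinner e f = (if e = f then 1 else 0)"
  shows "(\<Sum>e\<in>F. (cmod (cinner u (T e)))\<^sup>2) \<le> K\<^sup>2 * (norm u)\<^sup>2"
proof -
  define s where "s = (\<Sum>e\<in>F. (cmod (cinner u (T e)))\<^sup>2)"
  define w where "w = (\<Sum>e\<in>F. cinner (T e) u *\<^sub>C e)"
  have "s \<ge> 0" unfolding s_def by (intro sum_nonneg zero_le_power2)
  have "T w = (\<Sum>e\<in>F. cinner (T e) u *\<^sub>C T e)"
    unfolding w_def by (rule bounded_op_sum[OF T chilbert.subspace_UNIV UNIV_I])
  then have "cinner u (T w) = (\<Sum>e\<in>F. cinner u (T e) * cinner (T e) u)"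
    by (simp only: cinner_sum_right cinner_scaleC_right mult.commute)
  also have "\<dots> = of_real s" unfolding s_def of_real_sum cinner_mult_commute ..
  finally have "s \<le> cmod (cinner u (T w))" using \<open>s \<ge> 0\<close> by simp
  also have "\<dots> \<le> norm u * norm (T w)" by (rule cmod_cinner_le)
  also have "\<dots> \<le> norm u * (K * norm w)" by (intro mult_left_mono K norm_ge_zero)
  finally have "s\<^sup>2 \<le> (norm u * (K * norm w))\<^sup>2" using \<open>s \<ge> 0\<close> by (rule power_mono)
  also have "(norm w)\<^sup>2 = (\<Sum>e\<in>F. (cmod (cinner (T e) u))\<^sup>2)"
    unfolding w_def by (rule norm_sum_orthonormal[OF F])
  then have "(norm w)\<^sup>2 = s"
    by (simp only: s_def cinner_commute[of _ u] complex_mod_cnj)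
  then have "(norm u * (K * norm w))\<^sup>2 = (K\<^sup>2 * (norm u)\<^sup>2) * s" by (simp add: power_mult_distrib)
  finally have "s * s \<le> (K\<^sup>2 * (norm u)\<^sup>2) * s" by (simp only: power2_eq_square[of s])
  then have "s \<le> K\<^sup>2 * (norm u)\<^sup>2" using \<open>s \<ge> 0\<close>
    by (cases "s = 0") (simp_all add: mult_le_cancel_right)
  then show ?thesis by (simp only: s_def)
qed

lemma trace_summable_comp:
  assumes E: "orthonormal_basis E" and \<rho>: "positive_op UNIV \<rho>"
    and t: "((\<lambda>e. Re (cinner e (\<rho> e))) has_sum t) E" and T: "bounded_op UNIV T"
  shows "(\<lambda>e. cinner e (\<rho> (T e))) summable_on E"
proof -
  obtain K where K: "K \<ge> 0" "\<And>x. norm (T x) \<le> K * norm x" using bounded_op_bound[OF T] by auto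
  have pos: "Re (cinner x (\<rho> x)) \<ge> 0" for x using \<rho> by (simp add: positive_op_UNIV_iff)
  have le: "(\<Sum>e\<in>F. cmod (cinner e (\<rho> (T e)))) \<le> t + K\<^sup>2 * t" if F: "F \<subseteq> E" "finite F" for F
  proof -
    have on: "cinner e f = (if e = f then 1 else 0)" if "e \<in> F" "f \<in> F" for e f
      using bspec[OF bspec[OF conjunct1[OF E[unfolded orthonormal_basis_def]] subsetD[OF F(1) that(1)]]
          subsetD[OF F(1) that(2)]] .
    \<comment> \<open>The geometric mean from Cauchy-Schwarz is replaced by the sum of its two
      arguments. These sum up to at most \<open>t\<close> and \<open>K^2 * t\<close>.\<close>
    have "cmod (cinner e (\<rho> (T e))) \<le> Re (cinner e (\<rho> e)) + Re (cinner (T e) (\<rho> (T e)))" for e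
    proof -
      define x y where "x = Re (cinner e (\<rho> e))" and "y = Re (cinner (T e) (\<rho> (T e)))"
      have "(cmod (cinner e (\<rho> (T e))))\<^sup>2 \<le> x * y"
        unfolding x_def y_def by (rule positive_op_Cauchy_Schwarz[OF \<rho>])
      also have "x \<ge> 0" "y \<ge> 0" using pos by (simp_all add: x_def y_def)
      then have "x * y \<le> (x + y)\<^sup>2"
        using mult_nonneg_nonneg[of x y] sum_power2_ge_zero[of x y] unfolding power2_sum by linarith
      finally have "cmod (cinner e (\<rho> (T e))) \<le> x + y"
        by (rule power2_le_imp_le) (use \<open>x \<ge> 0\<close> \<open>y \<ge> 0\<close> in simp)
      then show ?thesis by (simp only: x_def y_def)
    qed
    then have "(\<Sum>e\<in>F. cmod (cinner e (\<rho> (T e))))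
        \<le> (\<Sum>e\<in>F. Re (cinner e (\<rho> e)) + Re (cinner (T e) (\<rho> (T e))))" by (rule sum_mono)
    also have "\<dots> = (\<Sum>e\<in>F. Re (cinner e (\<rho> e))) + (\<Sum>e\<in>F. Re (cinner (T e) (\<rho> (T e))))"
      by (rule sum.distrib)
    also have "\<dots> \<le> t + K\<^sup>2 * t"
    proof (rule add_mono)
      show "(\<Sum>e\<in>F. Re (cinner e (\<rho> e))) \<le> t" by (rule finite_sum_le_has_sum[OF t F(2,1) pos])
      show "(\<Sum>e\<in>F. Re (cinner (T e) (\<rho> (T e)))) \<le> K\<^sup>2 * t"
        using sum_cmod_cinner_image_le[OF T K F(2) on]
        by (intro sum_positive_op_le_trace[OF E F(2) zero_le_power2 _ \<rho> t])
    qed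
    finally show ?thesis .
  qed
  have "(\<lambda>e. cmod (cinner e (\<rho> (T e)))) summable_on E"
    using le by (intro nonneg_bdd_above_summable_on bdd_aboveI[of _ "t + K\<^sup>2 * t"]) auto
  then show ?thesis by (rule abs_summable_summable)
qed

text \<open>All statements on convergence refer to this one basis, the one that
  \<open>trace_op\<close> picks.\<close>

definition trace_basis :: "'b::chilbert_space set" where
  "trace_basis = (SOME E. orthonormal_basis E)"

lemma orthonormal_basis_trace_basis: "orthonormal_basis trace_basis"
  unfolding trace_basis_def using orthonormal_basis_exists by (rule someI_ex)

lemma trace_op_eq: "trace_op A = (\<Sum>\<^sub>\<infinity>e\<in>trace_basis. cinner e (A e))"
  by (simp add: trace_op_def trace_basis_def)

text \<open>A divergent series would have the value 0, so trace 1 already entails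
  convergence.\<close>

lemma quantum_state_has_sum:
  assumes "quantum_state \<rho>"
  shows "((\<lambda>e. cinner e (\<rho> e)) has_sum 1) trace_basis"
proof -
  have 1: "(\<Sum>\<^sub>\<infinity>e\<in>trace_basis. cinner e (\<rho> e)) = 1"
    using assms by (simp add: quantum_state_def trace_op_eq)
  have "(\<lambda>e. cinner e (\<rho> e)) summable_on trace_basis"
  proof (rule ccontr)
    assume "\<not> (\<lambda>e. cinner e (\<rho> e)) summable_on trace_basis"
    from infsum_not_exists[OF this] show False by (simp add: 1)
  qed
  from has_sum_infsum[OF this] show ?thesis by (simp only: 1)
qed

lemma quantum_state_comp_summable:
  assumes "quantum_state \<rho>" "bounded_op UNIV T"
  shows "(\<lambda>e. cinner e (\<rho> (T e))) summable_on trace_basis"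
proof (rule trace_summable_comp[OF orthonormal_basis_trace_basis _ _ assms(2)])
  show "positive_op UNIV \<rho>" using assms(1) by (simp add: quantum_state_def)
  show "((\<lambda>e. Re (cinner e (\<rho> e))) has_sum Re 1) trace_basis"
    by (rule has_sum_Re[OF quantum_state_has_sum[OF assms(1)]])
qed

lemma trace_op_sum:
  assumes "\<And>m. m \<in> I \<Longrightarrow> (\<lambda>e. cinner e (A m e)) summable_on trace_basis"
  shows "trace_op (\<lambda>x. \<Sum>m\<in>I. c m *\<^sub>R A m x) = (\<Sum>m\<in>I. of_real (c m) * trace_op (A m))"
proof -
  have "((\<lambda>e. \<Sum>m\<in>I. of_real (c m) * cinner e (A m e)) has_sum (\<Sum>m\<in>I. of_real (c m) * trace_op (A m)))
      trace_basis"
    unfolding trace_op_eq by (intro has_sum_sum has_sum_cmult_right has_sum_infsum assms)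
  then show ?thesis
    unfolding trace_op_eq cinner_sum_right cinner_scaleR_right by (rule infsumI)
qed

section \<open>Convex combinations of states\<close>

lemma positive_op_convex_sum:
  assumes "\<And>m. m \<in> I \<Longrightarrow> positive_op UNIV (\<rho> m)" "\<And>m. m \<in> I \<Longrightarrow> \<gamma> m \<ge> 0"
  shows "positive_op UNIV (\<lambda>x. \<Sum>m\<in>I. \<gamma> m *\<^sub>R \<rho> m x)"
  unfolding positive_op_UNIV_iff
proof (intro conjI allI)
  have bop: "bounded_op UNIV (\<rho> m)" if "m \<in> I" for m using assms(1)[OF that] by (simp add: positive_op_def)
  have "\<exists>K. \<forall>m. m \<in> I \<longrightarrow> (\<forall>x. norm (\<rho> m x) \<le> K m * norm x)"
  proof (intro choice allI)
    show "\<exists>K. m \<in> I \<longrightarrow> (\<forall>x. norm (\<rho> m x) \<le> K * norm x)" for m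
      using bop[of m] unfolding bounded_op_def by auto
  qed
  then obtain K where K: "\<And>m x. m \<in> I \<Longrightarrow> norm (\<rho> m x) \<le> K m * norm x" by blast
  have "norm (\<Sum>m\<in>I. \<gamma> m *\<^sub>R \<rho> m x) \<le> (\<Sum>m\<in>I. \<gamma> m * K m) * norm x" for x
  proof -
    have "norm (\<Sum>m\<in>I. \<gamma> m *\<^sub>R \<rho> m x) \<le> (\<Sum>m\<in>I. \<gamma> m * (K m * norm x))"
      using assms(2) K by (intro sum_norm_le) (simp add: mult_left_mono)
    then show ?thesis by (simp add: sum_distrib_right mult.assoc)
  qed
  moreover have "(\<Sum>m\<in>I. \<gamma> m *\<^sub>R \<rho> m (x + y)) = (\<Sum>m\<in>I. \<gamma> m *\<^sub>R \<rho> m x) + (\<Sum>m\<in>I. \<gamma> m *\<^sub>R \<rho> m y)" for x y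
    by (simp add: bounded_op_add[OF bop] scaleR_right_distrib sum.distrib cong: sum.cong)
  moreover have "(\<Sum>m\<in>I. \<gamma> m *\<^sub>R \<rho> m (c *\<^sub>C x)) = c *\<^sub>C (\<Sum>m\<in>I. \<gamma> m *\<^sub>R \<rho> m x)" for c x
    unfolding chilbert.scale_sum_right
  proof (rule sum.cong[OF refl])
    fix m assume m: "m \<in> I"
    show "\<gamma> m *\<^sub>R \<rho> m (c *\<^sub>C x) = c *\<^sub>C \<gamma> m *\<^sub>R \<rho> m x"
      unfolding bounded_op_scaleC[OF bop[OF m] UNIV_I] scaleC_of_real[symmetric] scaleC_scaleC
      by (simp only: mult.commute)
  qed
  ultimately show "bounded_op UNIV (\<lambda>x. \<Sum>m\<in>I. \<gamma> m *\<^sub>R \<rho> m x)" unfolding bounded_op_def by blast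
  show "0 \<le> Re (cinner x (\<Sum>m\<in>I. \<gamma> m *\<^sub>R \<rho> m x))" for x
    using assms unfolding cinner_sum_right cinner_scaleR_right Re_sum
    by (intro sum_nonneg) (simp add: positive_op_UNIV_iff)
  show "Im (cinner x (\<Sum>m\<in>I. \<gamma> m *\<^sub>R \<rho> m x)) = 0" for x
    using assms(1) unfolding cinner_sum_right cinner_scaleR_right Im_sum
    by (intro sum.neutral) (simp add: positive_op_UNIV_iff)
qed

lemma quantum_state_convex_sum:
  assumes "\<And>m. m \<in> I \<Longrightarrow> quantum_state (\<rho> m)" "\<And>m. m \<in> I \<Longrightarrow> \<gamma> m \<ge> 0" "sum \<gamma> I = 1"
  shows "quantum_state (\<lambda>x. \<Sum>m\<in>I. \<gamma> m *\<^sub>R \<rho> m x)"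
proof -
  have "trace_op (\<lambda>x. \<Sum>m\<in>I. \<gamma> m *\<^sub>R \<rho> m x) = (\<Sum>m\<in>I. of_real (\<gamma> m) * trace_op (\<rho> m))"
    by (rule trace_op_sum) (rule has_sum_imp_summable[OF quantum_state_has_sum[OF assms(1)]])
  also have "\<dots> = of_real (sum \<gamma> I)"
    unfolding of_real_sum by (rule sum.cong) (use assms(1) in \<open>simp_all add: quantum_state_def\<close>)
  finally show ?thesis
    using assms by (simp add: quantum_state_def positive_op_convex_sum)
qed

section \<open>Mixtures of LHV models\<close>

text \<open>Completion preserves almost-everywhere statements, measurability, and integrals of
  functions that were measurable before.\<close>

lemma LHV_model_completion:
  assumes "LHV_model N S \<Lambda> p \<nu> P"
  shows "LHV_model N S \<Lambda> p (completion \<nu>) P"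
  unfolding LHV_model_def
proof (intro conjI ballI)
  interpret prob_space \<nu> using assms by (simp add: LHV_model_def)
  show "prob_space (completion \<nu>)"
    by (rule prob_spaceI) (simp add: emeasure_space_1 sets.top)
next
  fix n s assume "n \<in> {1..N}" "s \<in> {1..S n}"
  then show "AE \<omega> in completion \<nu>. prob_space (P n s \<omega>) \<and> sets (P n s \<omega>) = sets (\<Lambda> n s)"
    using assms by (subst AE_completion_iff) (auto simp: LHV_model_def)
next
  fix n s D assume "n \<in> {1..N}" "s \<in> {1..S n}" "D \<in> sets (\<Lambda> n s)"
  then show "(\<lambda>\<omega>. measure (P n s \<omega>) D) \<in> borel_measurable (completion \<nu>)"
    using assms by (intro measurable_completion) (auto simp: LHV_model_def)
next
  fix s D assume s: "s \<in> (\<Pi>\<^sub>E n\<in>{1..N}. {1..S n})"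
    and D: "D \<in> (\<Pi>\<^sub>E n\<in>{1..N}. sets (\<Lambda> n (s n)))"
  have "(\<lambda>\<omega>. \<Prod>n=1..N. measure (P n (s n) \<omega>) (D n)) \<in> borel_measurable \<nu>"
  proof (rule borel_measurable_prod)
    fix n assume n: "n \<in> {1..N}"
    with s D have "s n \<in> {1..S n}" "D n \<in> sets (\<Lambda> n (s n))" by auto
    with n assms show "(\<lambda>\<omega>. measure (P n (s n) \<omega>) (D n)) \<in> borel_measurable \<nu>"
      unfolding LHV_model_def by blast
  qed
  then show "p s D = of_real (\<integral>\<omega>. (\<Prod>n=1..N. measure (P n (s n) \<omega>) (D n)) \<partial>completion \<nu>)"
    using assms s D by (simp add: LHV_model_def integral_completion)
qed

text \<open>The exceptional set lies in a null set, hence is measurable in the completion.\<close>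

lemma sets_completion_pred:
  assumes "AE \<omega> in completion M. Q \<omega>"
  shows "{\<omega> \<in> space M. Q \<omega>} \<in> sets (completion M)"
proof -
  have "Measurable.pred (completion M) (\<lambda>\<omega>. \<not> Q \<omega>)"
    using assms by (intro sets_completion_AE) (simp add: AE_completion_iff)
  then have "Measurable.pred (completion M) Q"
    using pred_intros_logic(2)[where P="\<lambda>\<omega>. \<not> Q \<omega>" and M="completion M"]
    by (simp only: not_not)
  then show ?thesis by (simp add: pred_def)
qed

text \<open>
  The hidden variables of the models may live on different \<open>\<sigma>\<close>-algebras. The disjoint union gets the
  largest one making all injections \<open>Pair m\<close> measurable. The models are completed first because
  the set where \<open>P n s \<omega>\<close> is a probability distribution on \<open>\<Lambda> n s\<close> need not be measurable.
\<close>

lemma LHV_model_mixture: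
  fixes q :: "'m pmf" and \<Lambda> :: "nat \<Rightarrow> nat \<Rightarrow> 'o measure"
  assumes fin: "finite (set_pmf q)"
    and ex: "\<And>m. m \<in> set_pmf q \<Longrightarrow> admits_LHV_model N S \<Lambda> (p m)"
    and p': "\<And>s D. s \<in> (\<Pi>\<^sub>E n\<in>{1..N}. {1..S n}) \<Longrightarrow> D \<in> (\<Pi>\<^sub>E n\<in>{1..N}. sets (\<Lambda> n (s n))) \<Longrightarrow>
      p' s D = (\<Sum>m\<in>set_pmf q. of_real (pmf q m) * p m s D)"
  shows "admits_LHV_model N S \<Lambda> p'"
proof -
  \<comment> \<open>Labels outside the support get the model of \<open>m0\<close>. Thus every label
    has a model and \<open>k\<close> is a probability kernel everywhere; these labels have weight
    0.\<close>
  obtain m0 where m0: "m0 \<in> set_pmf q" using set_pmf_not_empty by fastforce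
  have "\<exists>z. LHV_model N S \<Lambda> (p (if m \<in> set_pmf q then m else m0))
      (completion (fst z :: (nat \<Rightarrow> nat \<Rightarrow> 'o measure) measure)) (snd z)" for m
  proof -
    have "admits_LHV_model N S \<Lambda> (p (if m \<in> set_pmf q then m else m0))" using ex m0 by simp
    then obtain \<nu> :: "(nat \<Rightarrow> nat \<Rightarrow> 'o measure) measure" and P
      where "LHV_model N S \<Lambda> (p (if m \<in> set_pmf q then m else m0)) \<nu> P"
      unfolding admits_LHV_model_def by blast
    then show ?thesis by (intro exI[of _ "(\<nu>, P)"]) (simp add: LHV_model_completion)
  qed
  then have "\<exists>z. \<forall>m. LHV_model N S \<Lambda> (p (if m \<in> set_pmf q then m else m0))
      (completion (fst (z m) :: (nat \<Rightarrow> nat \<Rightarrow> 'o measure) measure)) (snd (z m))"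
    by (intro choice) blast
  then obtain z where z: "\<And>m. LHV_model N S \<Lambda> (p (if m \<in> set_pmf q then m else m0))
      (completion (fst (z m) :: (nat \<Rightarrow> nat \<Rightarrow> 'o measure) measure)) (snd (z m))"
    by blast
  define \<nu> where "\<nu> m = fst (z m)" for m
  define P where "P m = snd (z m)" for m
  have mod: "LHV_model N S \<Lambda> (p (if m \<in> set_pmf q then m else m0)) (completion (\<nu> m)) (P m)" for m
    using z by (simp add: \<nu>_def P_def)
  have prob: "prob_space (completion (\<nu> m))" for m using mod by (simp add: LHV_model_def)
  define \<A> where "\<A> = {A. \<forall>m. Pair m -` A \<inter> space (completion (\<nu> m)) \<in> sets (completion (\<nu> m))}"
  define T where "T = sigma UNIV \<A>"
  have "sigma_algebra UNIV \<A>"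
    unfolding sigma_algebra_iff2
  proof (intro conjI ballI allI impI)
    show "UNIV - A \<in> \<A>" if "A \<in> \<A>" for A
    proof -
      have "Pair m -` (UNIV - A) \<inter> space (completion (\<nu> m))
          = space (completion (\<nu> m)) - (Pair m -` A \<inter> space (completion (\<nu> m)))" for m by auto
      then show ?thesis using that by (auto simp: \<A>_def simp del: space_completion)
    qed
    show "(\<Union>i. A i) \<in> \<A>" if "range A \<subseteq> \<A>" for A :: "nat \<Rightarrow> _"
    proof -
      have "Pair m -` (\<Union>i. A i) \<inter> space (completion (\<nu> m))
          = (\<Union>i. Pair m -` A i \<inter> space (completion (\<nu> m)))" for m by auto
      moreover have "(\<Union>i. Pair m -` A i \<inter> space (completion (\<nu> m))) \<in> sets (completion (\<nu> m))" for m
        by (rule sets.countable_UN) (use that in \<open>auto simp: \<A>_def\<close>)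
      ultimately show ?thesis by (simp add: \<A>_def)
    qed
  qed (auto simp: \<A>_def)
  then have sets_T: "sets T = \<A>" and space_T: "space T = UNIV"
    by (simp_all add: T_def sigma_algebra.sigma_sets_eq)
  have Pair: "Pair m \<in> completion (\<nu> m) \<rightarrow>\<^sub>M T" for m
    by (rule measurableI) (auto simp: sets_T space_T \<A>_def)
  have meas: "g \<in> borel_measurable T"
    if "\<And>m. (\<lambda>\<omega>. g (m, \<omega>)) \<in> borel_measurable (completion (\<nu> m))" for g :: "_ \<Rightarrow> real"
  proof (rule measurableI)
    fix A :: "real set" assume "A \<in> sets borel"
    then have "(\<lambda>\<omega>. g (m, \<omega>)) -` A \<inter> space (completion (\<nu> m)) \<in> sets (completion (\<nu> m))" for m
      using that by (rule measurable_sets[rotated])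
    moreover have "(\<lambda>\<omega>. g (m, \<omega>)) -` A \<inter> space (completion (\<nu> m))
        = Pair m -` (g -` A) \<inter> space (completion (\<nu> m))" for m by auto
    ultimately show "g -` A \<inter> space T \<in> sets T" by (simp add: sets_T space_T \<A>_def)
  qed simp
  define k where "k m = distr (completion (\<nu> m)) T (Pair m)" for m
  have prob_k: "prob_space (k m)" for m
    unfolding k_def by (rule prob_space.prob_space_distr[OF prob Pair])
  have k: "k \<in> measure_pmf q \<rightarrow>\<^sub>M subprob_algebra T"
    using prob_k by (auto simp: space_subprob_algebra prob_space_imp_subprob_space) (simp_all add: k_def)
  \<comment> \<open>Draw a label from \<open>q\<close>, then a hidden variable from the model with
    that label.\<close>
  define \<mu> where "\<mu> = measure_pmf q \<bind> k"
  \<comment> \<open>Locality is kept: the response uses the label, the variable of that component,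
    the site and its own setting.\<close>
  define R where "R = (\<lambda>n s (m, \<omega>). P m n s \<omega>)"
  have sets_\<mu>: "sets \<mu> = sets T" unfolding \<mu>_def by (rule sets_bind) (auto simp: k_def)
  have "LHV_model N S \<Lambda> p' \<mu> R"
    unfolding LHV_model_def
  proof (intro conjI ballI)
    show "prob_space \<mu>" unfolding \<mu>_def
      by (rule prob_space.prob_space_bind[OF prob_space_measure_pmf _ k]) (simp add: prob_k)
  next
    fix n s assume ns: "n \<in> {1..N}" "s \<in> {1..S n}"
    let ?Q = "\<lambda>w. prob_space (R n s w) \<and> sets (R n s w) = sets (\<Lambda> n s)"
    have AE: "AE \<omega> in completion (\<nu> m). ?Q (m, \<omega>)" for m
      using mod[of m] ns by (auto simp: LHV_model_def R_def)
    have "Pair m -` {w. ?Q w} \<inter> space (completion (\<nu> m)) \<in> sets (completion (\<nu> m))" for m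
      using sets_completion_pred[OF AE[of m]] by (simp add: vimage_def Int_def conj_commute)
    then have pred: "{w \<in> space T. ?Q w} \<in> sets T" by (simp add: sets_T space_T \<A>_def)
    have "AE w in k m. ?Q w" for m
      unfolding k_def by (subst AE_distr_iff[OF Pair pred]) (rule AE)
    then show "AE w in \<mu>. ?Q w"
      unfolding \<mu>_def by (subst AE_bind[OF k]) (use pred in \<open>auto simp: pred_def\<close>)
  next
    fix n s D assume "n \<in> {1..N}" "s \<in> {1..S n}" "D \<in> sets (\<Lambda> n s)"
    then have "(\<lambda>w. measure (R n s w) D) \<in> borel_measurable T"
      using mod by (intro meas) (auto simp: LHV_model_def R_def)
    then show "(\<lambda>w. measure (R n s w) D) \<in> borel_measurable \<mu>"
      by (simp add: measurable_cong_sets[OF sets_\<mu> refl])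
  next
    fix s D assume s: "s \<in> (\<Pi>\<^sub>E n\<in>{1..N}. {1..S n})"
      and D: "D \<in> (\<Pi>\<^sub>E n\<in>{1..N}. sets (\<Lambda> n (s n)))"
    let ?g = "\<lambda>w. \<Prod>n=1..N. measure (R n (s n) w) (D n)"
    have g: "?g \<in> borel_measurable T"
    proof (rule borel_measurable_prod)
      fix n assume n: "n \<in> {1..N}"
      with s D have "s n \<in> {1..S n}" "D n \<in> sets (\<Lambda> n (s n))" by auto
      with n show "(\<lambda>w. measure (R n (s n) w) (D n)) \<in> borel_measurable T"
        using mod by (intro meas) (auto simp: LHV_model_def R_def)
    qed
    have one: "AE w in k m. norm (?g w) \<le> 1" for m
    proof -
      have "AE w in completion (\<nu> m). \<forall>n\<in>{1..N}. prob_space (P m n (s n) w)"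
        using mod[of m] s by (intro AE_finite_allI) (auto simp: LHV_model_def PiE_iff)
      then have "AE w in completion (\<nu> m). norm (?g (m, w)) \<le> 1"
        by eventually_elim (auto simp: R_def abs_prod intro!: prod_le_1 prob_space.prob_le_1)
      moreover have "{w \<in> space T. norm (?g w) \<le> 1} \<in> sets T" using g by measurable
      ultimately show ?thesis unfolding k_def by (subst AE_distr_iff[OF Pair]) auto
    qed
    have "(\<integral>w. ?g w \<partial>\<mu>) = (\<integral>m. \<integral>w. ?g w \<partial>k m \<partial>measure_pmf q)"
    proof -
      \<comment> \<open>Responses are probability distributions only almost everywhere, so
        \<open>?g\<close> is bounded by 1 only almost everywhere, whereas the rule for integrals
        over \<open>\<mu>\<close> asks for a bound at every point. Truncation provides it and
        changes none of the integrals.\<close>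
      let ?h = "\<lambda>w. min 1 (?g w)"
      have h: "?h \<in> borel_measurable T" using g by simp
      have eq: "{w \<in> space T. ?g w = ?h w} \<in> sets T" using g by measurable
      have k_eq: "AE w in k m. ?g w = ?h w" for m
        using one[of m] by eventually_elim auto
      then have \<mu>_eq: "AE w in \<mu>. ?g w = ?h w"
        unfolding \<mu>_def by (subst AE_bind[OF k]) (use eq in \<open>auto simp: pred_def\<close>)
      have k_int: "(\<integral>w. ?h w \<partial>k m) = (\<integral>w. ?g w \<partial>k m)" for m
      proof (rule integral_cong_AE)
        show "AE w in k m. ?h w = ?g w" using k_eq[of m] by eventually_elim simp
      qed (use g h in \<open>simp_all add: k_def\<close>)
      have "(\<integral>w. ?g w \<partial>\<mu>) = (\<integral>w. ?h w \<partial>\<mu>)"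
        using g h by (intro integral_cong_AE \<mu>_eq) (simp_all add: measurable_cong_sets[OF sets_\<mu> refl])
      also have "\<dots> = (\<integral>m. \<integral>w. ?h w \<partial>k m \<partial>measure_pmf q)"
        unfolding \<mu>_def
      proof (rule integral_bind[OF h _ k])
        show "\<bar>?h w\<bar> \<le> 1" for w
        proof -
          have "0 \<le> ?g w" by (intro prod_nonneg) simp
          then show ?thesis by linarith
        qed
        show "finite_measure (measure_pmf q)" by (rule measure_pmf.finite_measure_axioms)
        show "AE m in measure_pmf q. emeasure (k m) (space (k m)) \<le> ennreal 1"
          by (simp add: prob_space.emeasure_space_1[OF prob_k])
      qed
      finally show ?thesis by (simp only: k_int)
    qed
    also have "\<dots> = (\<Sum>m\<in>set_pmf q. (\<integral>w. ?g w \<partial>k m) * pmf q m)"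
      using fin by (intro integral_measure_pmf_real) auto
    also have "complex_of_real \<dots> = (\<Sum>m\<in>set_pmf q. of_real (pmf q m) * p m s D)"
      unfolding of_real_sum
    proof (rule sum.cong[OF refl])
      fix m assume m: "m \<in> set_pmf q"
      have "(\<integral>w. ?g w \<partial>k m) = (\<integral>\<omega>. ?g (m, \<omega>) \<partial>completion (\<nu> m))"
        unfolding k_def by (rule integral_distr[OF Pair g])
      then have "p m s D = of_real (\<integral>w. ?g w \<partial>k m)"
        using mod[of m] m s D by (simp add: LHV_model_def R_def)
      then show "complex_of_real ((\<integral>w. ?g w \<partial>k m) * pmf q m) = of_real (pmf q m) * p m s D"
        by simp
    qed
    finally show "p' s D = of_real (\<integral>w. ?g w \<partial>\<mu>)" by (simp only: p'[OF s D])
  qed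
  \<comment> \<open>The labelled variables have a type of their own; the model is transported back
    to the fixed type of hidden variables.\<close>
  then show ?thesis by (rule admits_LHV_model_if_LHV_model)
qed

text \<open>Weights may be zero, hence only an inclusion for the support.\<close>

lemma pmf_of_weights:
  fixes \<gamma> :: "'m \<Rightarrow> real"
  assumes "finite I" "\<And>m. m \<in> I \<Longrightarrow> \<gamma> m \<ge> 0" "sum \<gamma> I = 1"
  obtains q where "set_pmf q \<subseteq> I" "\<And>m. m \<in> I \<Longrightarrow> pmf q m = \<gamma> m"
proof -
  define f where "f m = (if m \<in> I then \<gamma> m else 0)" for m
  have nonneg: "f m \<ge> 0" for m using assms(2) by (simp add: f_def)
  have "(\<integral>\<^sup>+m. ennreal (f m) \<partial>count_space UNIV) = (\<Sum>m\<in>I. ennreal (f m))"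
    using assms(1) by (intro nn_integral_count_space'[of I]) (simp_all add: f_def)
  also have "\<dots> = ennreal (\<Sum>m\<in>I. f m)" using nonneg by (simp add: sum_ennreal)
  also have "(\<Sum>m\<in>I. f m) = 1" using assms(3) by (simp add: f_def)
  finally have prob: "(\<integral>\<^sup>+m. ennreal (f m) \<partial>count_space UNIV) = 1" by simp
  have q: "pmf (embed_pmf f) m = f m" for m by (rule pmf_embed_pmf[OF nonneg prob])
  show ?thesis
  proof (rule that[of "embed_pmf f"])
    show "set_pmf (embed_pmf f) \<subseteq> I" unfolding set_pmf_eq q by (auto simp: f_def)
  qed (simp add: q f_def)
qed

text \<open>The effects of a POV measure are bounded, so their tensor product is a bounded operator
  and each state gives a convergent trace series, to which finite additivity applies.\<close>

lemma joint_prob_convex_sum: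
  assumes H: "\<And>n. n \<in> {1..N} \<Longrightarrow> separable_hilbert_subspace (H n)"
    and \<tau>: "hilbert_tensor_product N H \<tau>"
    and M: "measurement_family N S H \<Lambda> M"
    and s: "s \<in> (\<Pi>\<^sub>E n\<in>{1..N}. {1..S n})" and D: "D \<in> (\<Pi>\<^sub>E n\<in>{1..N}. sets (\<Lambda> n (s n)))"
    and \<rho>: "\<And>m. m \<in> I \<Longrightarrow> quantum_state (\<rho> m)"
  shows "joint_prob N H \<tau> M (\<lambda>x. \<Sum>m\<in>I. \<gamma> m *\<^sub>R \<rho> m x) s D
    = (\<Sum>m\<in>I. of_real (\<gamma> m) * joint_prob N H \<tau> M (\<rho> m) s D)"
proof -
  define T where "T = tensor_op N H \<tau> (\<lambda>n. M n (s n) (D n))"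
  have "bounded_op (H n) (M n (s n) (D n))" if n: "n \<in> {1..N}" for n
  proof -
    have "pov_measure (H n) (\<Lambda> n (s n)) (M n (s n))"
      by (rule bspec[OF bspec[OF M[unfolded measurement_family_def] n] PiE_mem[OF s n]])
    then have "\<forall>D\<in>sets (\<Lambda> n (s n)). positive_op (H n) (M n (s n) D)"
      unfolding pov_measure_def by (rule conjunct1)
    from bspec[OF this PiE_mem[OF D n]] show ?thesis unfolding positive_op_def by (rule conjunct1)
  qed
  then have T: "bounded_op UNIV T"
    unfolding T_def using H \<tau> by (intro bounded_op_tensor_op) (simp_all add: separable_hilbert_subspace_def)
  have "trace_op (\<lambda>x. \<Sum>m\<in>I. \<gamma> m *\<^sub>R (\<rho> m \<circ> T) x) = (\<Sum>m\<in>I. of_real (\<gamma> m) * trace_op (\<rho> m \<circ> T))"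
    using quantum_state_comp_summable[OF \<rho> T] by (intro trace_op_sum) simp
  then show ?thesis by (simp add: joint_prob_def comp_def flip: T_def)
qed

theorem proposition5:
  fixes N K :: nat and S :: "nat \<Rightarrow> nat"
    and H :: "nat \<Rightarrow> 'a::chilbert_space set"
    and \<tau> :: "(nat \<Rightarrow> 'a) \<Rightarrow> 'b::chilbert_space"
    and \<rho> :: "nat \<Rightarrow> 'b \<Rightarrow> 'b"
    and \<gamma> :: "nat \<Rightarrow> real"
  assumes "\<forall>n\<in>{1..N}. separable_hilbert_subspace (H n)"
    and "hilbert_tensor_product N H \<tau>"
    and "\<forall>n\<in>{1..N}. S n \<ge> 1"
    and "(\<Sum>n=1..N. S n) > N"
    and "\<forall>m\<in>{1..K}. admits_LHV_description TYPE('o) N S H \<tau> (\<rho> m)"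
    and "\<forall>m\<in>{1..K}. \<gamma> m \<ge> 0"
    and "(\<Sum>m=1..K. \<gamma> m) = 1"
  shows "admits_LHV_description TYPE('o) N S H \<tau> (\<lambda>x. \<Sum>m=1..K. \<gamma> m *\<^sub>R \<rho> m x)"
proof -
  have state: "quantum_state (\<rho> m)" if "m \<in> {1..K}" for m
    using assms(5) that unfolding admits_LHV_description_def by blast
  obtain q where q: "set_pmf q \<subseteq> {1..K}" "\<And>m. m \<in> {1..K} \<Longrightarrow> pmf q m = \<gamma> m"
    using pmf_of_weights[of "{1..K}" \<gamma>] assms(6,7) by auto
  show ?thesis
    unfolding admits_LHV_description_def
  proof (intro conjI allI impI)
    show "quantum_state (\<lambda>x. \<Sum>m=1..K. \<gamma> m *\<^sub>R \<rho> m x)"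
      using assms(6,7) state by (intro quantum_state_convex_sum) simp_all
  next
    fix \<Lambda> :: "nat \<Rightarrow> nat \<Rightarrow> 'o measure" and M
    assume M: "measurement_family N S H \<Lambda> M"
    show "admits_LHV_model N S \<Lambda> (joint_prob N H \<tau> M (\<lambda>x. \<Sum>m=1..K. \<gamma> m *\<^sub>R \<rho> m x))"
    proof (rule LHV_model_mixture[of q N S \<Lambda> "\<lambda>m. joint_prob N H \<tau> M (\<rho> m)"])
      show "finite (set_pmf q)" using q(1) finite_atLeastAtMost by (rule finite_subset)
      show "admits_LHV_model N S \<Lambda> (joint_prob N H \<tau> M (\<rho> m))" if "m \<in> set_pmf q" for m
        using assms(5) q(1) that M unfolding admits_LHV_description_def by blast
    next
      fix s D
      assume sD: "s \<in> (\<Pi>\<^sub>E n\<in>{1..N}. {1..S n})" "D \<in> (\<Pi>\<^sub>E n\<in>{1..N}. sets (\<Lambda> n (s n)))"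
      have "joint_prob N H \<tau> M (\<lambda>x. \<Sum>m=1..K. \<gamma> m *\<^sub>R \<rho> m x) s D
          = (\<Sum>m=1..K. of_real (\<gamma> m) * joint_prob N H \<tau> M (\<rho> m) s D)"
        by (rule joint_prob_convex_sum[OF bspec[OF assms(1)] assms(2) M sD state])
      also have "\<dots> = (\<Sum>m=1..K. of_real (pmf q m) * joint_prob N H \<tau> M (\<rho> m) s D)"
        by (rule sum.cong[OF refl]) (simp only: q(2))
      \<comment> \<open>Components of weight 0 are dropped here, as they lie outside the
        support.\<close>
      also have "\<dots> = (\<Sum>m\<in>set_pmf q. of_real (pmf q m) * joint_prob N H \<tau> M (\<rho> m) s D)"
        using q(1) by (intro sum.mono_neutral_right) (auto simp: set_pmf_iff)
      finally show "joint_prob N H \<tau> M (\<lambda>x. \<Sum>m=1..K. \<gamma> m *\<^sub>R \<rho> m x) s D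
          = (\<Sum>m\<in>set_pmf q. of_real (pmf q m) * joint_prob N H \<tau> M (\<rho> m) s D)" .
    qed
  qed
qed

end
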